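(* Let $q$ be a power of $2$ and $A=\mathbb{F}_q[t]$. Then the following hold. (1) Let $s$ be an integer with $1\le s\le q$ and let $k_1,\dots,k_{s-1}\in\{0,1\}$ with $k_1\le\dots\le k_{s-1}$. Let $b=sq^2-\sum_{i=1}^{s-1}q^{k_i}-1$ and $b'=sq^2-\sum_{i=1}^{s-1}q^{k_i}-q$. Then $$\zeta(2,b)=\frac{[1]^q}{[2]}\,\zeta(q+1,b').$$ (2) $$\zeta(2,\,2q^2-3q+1)=\frac{[1]^q}{[2]}\,\zeta(q+1,\,2q^2-4q+2).$$ (3) Let $s$ be an integer with $1\le s<q$ and let $k_1,\dots,k_s,l_1,\dots,l_s\in\{0,1\}$ with $l_1\le\dots\le l_s$, $k_1\le\dots\le k_s$, $l_i\le k_i$ for all $i$, and $l_i<k_i$ for exactly one index $i$. Then $$\zeta\Big(q^2-\sum_{i=1}^s q^{k_i},\ 2q^2-3q+1\Big)=\frac{[1]^q}{[2]}\,\zeta\Big(q^2-\sum_{i=1}^s q^{l_i},\ 2q^2-4q+2\Big).$$ (4) Let $i,j$ be integers with $0\le i\le 2$ and $0\le j\le 2-i$. Let $b=q^3-iq^2-jq-(q-i-j)$ and $b'=q^3-iq^2-(q-(2-j))q-(2-i-j)$. Then $$\zeta(4q-2,\,b)=\frac{[1]^{(q-2)q}}{[2]^{q-2}}\,\zeta(q^2+q,\,b').$$ (5) If moreover $q>2$, then for each integer $i$ with $0\le i\le 2$, $$\zeta\big(3q-1,\ q^3-(q-1)-q^i\big)=\frac{[1]^{(q-1)q}}{[2]^{q-1}}\,\zeta\big(q^2+q,\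 q^3-(q-1)q-q^i\big).$$
   Context: $\mathbb{F}_q$ is a finite field with $q$ elements, $A=\mathbb{F}_q[t]$, $K=\mathbb{F}_q(t)$, and $K_\infty=\mathbb{F}_q((1/t))$. For an integer $n\ge1$, $[n]:=t^{q^n}-t\in A$. For positive integers $s_1,s_2$, the depth-two multizeta value is $$\zeta(s_1,s_2):=\sum\frac{1}{a_1^{s_1}a_2^{s_2}}\in K_\infty,$$ where the sum runs over all pairs of monic polynomials $a_1,a_2\in A$ with $\deg a_1>\deg a_2\ge 0$. *)

theory Defs
  imports "HOL-Analysis.Analysis" "HOL-Computational_Algebra.Computational_Algebra"
begin

text \<open>
  For a finite field \<open>'a\<close> with \<open>q = CARD('a)\<close> elements, \<open>'a poly\<close> is \<open>A = F_q[t]\<close> and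
  \<open>K_\<infinity> = F_q((1/t))\<close> is \<open>'a fls\<close>, the variable \<open>fls_X\<close> being \<open>1/t\<close>.  The metric of
  \<open>'a fls\<close> is the one of the \<open>1/t\<close>-adic valuation, so infinite sums are sums
  in \<open>K_\<infinity>\<close>.
\<close>

definition to_K_inf :: "'a::field poly \<Rightarrow> 'a fls" where
  "to_K_inf p = poly (map_poly fls_const p) fls_X_inv"

definition bracket :: "nat \<Rightarrow> 'a::finite_field poly" where
  "bracket n = [:0, 1:] ^ (CARD('a) ^ n) - [:0, 1:]"

definition monic_pairs :: "('a::finite_field poly \<times> 'a poly) set" where
  "monic_pairs = {(a1, a2). lead_coeff a1 = 1 \<and> lead_coeff a2 = 1 \<and> degree a1 > degree a2}"

text \<open>
  The exponents are integers, so that differences occurring as exponents are not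
  truncated; the definition is meant for positive \<open>s1\<close> and \<open>s2\<close>, where
  the sum converges (lemma \<open>zeta2_summable\<close> below).
\<close>

definition zeta2 :: "int \<Rightarrow> int \<Rightarrow> 'a::finite_field fls" where
  "zeta2 s1 s2 =
     (\<Sum>\<^sub>\<infinity>(a1, a2)\<in>monic_pairs. 1 / (to_K_inf a1 powi s1 * to_K_inf a2 powi s2))"

unbundle fps_syntax

lemma fls_summable_onI:
  fixes f :: "'b \<Rightarrow> 'a::field fls"
  assumes nonneg: "\<And>x k. x \<in> A \<Longrightarrow> k < 0 \<Longrightarrow> f x $$ k = 0"
  assumes fin: "\<And>n. finite {x\<in>A. \<exists>k\<le>n. f x $$ k \<noteq> 0}"
  shows "f summable_on A"
proof -
  define F where "F n = {x\<in>A. \<exists>k\<le>n. f x $$ k \<noteq> 0}" for n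
  define L where "L = Abs_fls (\<lambda>k. \<Sum>x\<in>F k. f x $$ k)"
  have L_nth: "L $$ k = (\<Sum>x\<in>F k. f x $$ k)" for k
    unfolding L_def
  proof (rule nth_Abs_fls_lower_bound)
    show "\<forall>k<0. (\<Sum>x\<in>F k. f x $$ k) = 0"
      by (auto intro!: sum.neutral nonneg simp: F_def)
  qed
  have sum_nth: "sum f Y $$ k = (\<Sum>x\<in>Y. f x $$ k)" if "finite Y" for Y k
    using that by induction auto
  have eq: "sum f Y $$ k = L $$ k" if Y: "finite Y" "F n \<subseteq> Y" "Y \<subseteq> A" and k: "k \<le> n" for Y k n
    unfolding sum_nth[OF Y(1)] L_nth
    by (rule sum.mono_neutral_right) (use Y k in \<open>auto simp: F_def intro: order_trans\<close>)
  have "(f has_sum L) A"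
    unfolding has_sum_def tendsto_iff
  proof (intro allI impI)
    fix e :: real assume "e > 0"
    then obtain n :: nat where n: "inverse (2 ^ n) < e"
      by (metis power_inverse inverse_eq_divide one_less_numeral_iff semiring_norm(76)
            reals_power_lt_ex)
    show "eventually (\<lambda>Y. dist (sum f Y) L < e) (finite_subsets_at_top A)"
      unfolding eventually_finite_subsets_at_top
    proof (intro exI[of _ "F (int n)"] conjI allI impI)
      show "finite (F (int n))" using fin by (simp add: F_def)
      show "F (int n) \<subseteq> A" by (auto simp: F_def)
      fix Y assume Y: "finite Y \<and> F (int n) \<subseteq> Y \<and> Y \<subseteq> A"
      show "dist (sum f Y) L < e"
      proof (cases "sum f Y = L")
        case False
        have "fls_subdegree (sum f Y - L) \<ge> int n"
          using False Y eq[of Y "int n"] by (intro fls_subdegree_geI) auto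
        then have "dist (sum f Y) L \<le> inverse (2 ^ n)"
          using False by (auto simp: dist_fls_def intro!: le_imp_inverse_le power_increasing)
        with n show ?thesis by simp
      qed (use \<open>e > 0\<close> in simp)
    qed
  qed
  then show ?thesis by (auto simp: summable_on_def)
qed

lemma to_K_inf_nth:
  "to_K_inf p $$ k = (if k \<le> 0 then coeff p (nat (- k)) else 0)"
proof (induction p arbitrary: k)
  case 0
  then show ?case by (simp add: to_K_inf_def)
next
  case (pCons a p)
  have "to_K_inf (pCons a p) = fls_const a + fls_X_inv * to_K_inf p"
    by (simp add: to_K_inf_def map_poly_pCons)
  then have "to_K_inf (pCons a p) $$ k = (if k = 0 then a else 0) + to_K_inf p $$ (k + 1)"
    by (simp add: fls_X_inv_times_conv_shift)
  moreover have "nat (- k) = Suc (nat (- (k + 1)))" if "k < 0"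
    using that by simp
  ultimately show ?case
    using pCons.IH by (auto simp: coeff_pCons split: nat.splits)
qed

lemma to_K_inf_subdegree:
  "p \<noteq> 0 \<Longrightarrow> fls_subdegree (to_K_inf p) = - int (degree p)"
  by (rule fls_subdegree_eqI) (auto simp: to_K_inf_nth coeff_eq_0)

lemma zeta2_summable:
  assumes "s1 > 0" "s2 > 0"
  shows "(\<lambda>(a1, a2). 1 / (to_K_inf a1 powi s1 * to_K_inf a2 powi s2) :: 'a::finite_field fls)
           summable_on monic_pairs"
proof -
  define f where "f = (\<lambda>(a1, a2). 1 / (to_K_inf a1 powi s1 * to_K_inf a2 powi s2) :: 'a fls)"
  have zero: "f (a1, a2) $$ k = 0" if "(a1, a2) \<in> monic_pairs" "k < int (degree a1)" for a1 a2 k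
  proof -
    have nz: "a1 \<noteq> 0" "a2 \<noteq> 0" using that by (auto simp: monic_pairs_def)
    then have nz': "to_K_inf a1 \<noteq> 0" "to_K_inf a2 \<noteq> 0"
      by (metis leading_coeff_0_iff to_K_inf_nth fls_zero_nth neg_le_0_iff_le nat_int
            of_nat_0_le_iff minus_minus)+
    have "f (a1, a2) = inverse (to_K_inf a1 ^ nat s1 * to_K_inf a2 ^ nat s2)"
      using assms by (simp add: f_def power_int_def inverse_eq_divide)
    moreover have "fls_subdegree (inverse (to_K_inf a1 ^ nat s1 * to_K_inf a2 ^ nat s2)) =
        s1 * int (degree a1) + s2 * int (degree a2)"
      using nz nz' assms by (simp add: fls_inverse_subdegree fls_subdegree_pow to_K_inf_subdegree)
    moreover have "int (degree a1) \<le> s1 * int (degree a1)"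
      using assms mult_right_mono[of 1 s1 "int (degree a1)"] by simp
    ultimately show ?thesis
      using that assms by (intro fls_eq0_below_subdegree) (simp add: add_increasing2 less_le_trans)
  qed
  have "f summable_on monic_pairs"
  proof (rule fls_summable_onI)
    show "f x $$ k = 0" if "x \<in> monic_pairs" "k < 0" for x k
      using zero[of "fst x" "snd x" k] that by simp
    show "finite {x \<in> monic_pairs. \<exists>k\<le>n. f x $$ k \<noteq> 0}" for n
    proof (rule finite_subset)
      let ?D = "{p :: 'a poly. degree p \<le> nat n}"
      show "{x \<in> monic_pairs. \<exists>k\<le>n. f x $$ k \<noteq> 0}
            \<subseteq> ?D \<times> ?D"
      proof safe
        fix a1 a2 :: "'a poly" and k
        assume *: "(a1, a2) \<in> monic_pairs" "k \<le> n"
          "f (a1, a2) $$ k \<noteq> 0"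
        then have "int (degree a1) \<le> k"
          using zero[of a1 a2 k] by force
        with * show "degree a1 \<le> nat n" "degree a2 \<le> nat n"
          by (auto simp: monic_pairs_def)
      qed
      have "?D \<subseteq> Poly ` {xs. set xs \<subseteq> UNIV \<and> length xs \<le> Suc (nat n)}"
      proof
        fix p :: "'a poly" assume "p \<in> ?D"
        then have "length (coeffs p) \<le> Suc (nat n)"
          by (cases "p = 0") (auto simp: length_coeffs_degree)
        then show "p \<in> Poly ` {xs. set xs \<subseteq> UNIV \<and> length xs \<le> Suc (nat n)}"
          by (intro image_eqI[of _ _ "coeffs p"]) auto
      qed
      then have "finite ?D"
        by (rule finite_subset) (intro finite_imageI finite_lists_length_le finite)
      then show "finite (?D \<times> ?D)" by simp
    qed
  qed
  then show ?thesis by (simp only: f_def)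
qed

unbundle no fps_syntax

end

theory Submission
  imports Defs
begin

text \<open>
  Write \<open>S_d(n)\<close> for the sum of \<open>1 / a^n\<close> over the monic \<open>a\<close> of degree \<open>d\<close>, and \<open>S_{<d}(n)\<close> for
  the sum over the monic \<open>a\<close> of degree less than \<open>d\<close>. Each identity already holds for every
  \<open>d\<close> between the products \<open>S_d(s1) S_{<d}(s2)\<close>, whose sum over \<open>d\<close> is \<open>\<zeta>(s1, s2)\<close>.

  Let \<open>\<epsilon>(x) = e0 x + e1 x^q + e2 x^(q^2) + \<dots>\<close> be the Carlitz polynomial that vanishes in degree less
  than \<open>d\<close> and is \<open>1\<close> on the monic polynomials of degree \<open>d\<close>. The logarithmic derivatives of
  \<open>\<epsilon>(x) - 1\<close> and \<open>\<epsilon>(x) / x\<close> give linear recurrences for \<open>S_d(n)\<close> and, if \<open>q - 1\<close> divides \<open>n\<close>, for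
  \<open>S_{<d}(n)\<close>. In the ranges of the theorem these involve \<open>e0, e1, e2\<close> only, and together with
  \<open>S(q n) = S(n)^q\<close> they give closed forms. With \<open>\<beta> = e1 / e0\<close>, \<open>\<alpha> = \<beta>^(q + 1) + e2 / e0\<close> and
  \<open>\<nu> = e0^q + e1\<close>, passing from \<open>S_{<d}(b)\<close> to \<open>S_{<d}(b')\<close> replaces a power of \<open>\<alpha>\<close> by the same
  power of \<open>\<beta>^q\<close>, the matching change in \<open>S_d\<close> replaces \<open>e0\<close> by \<open>\<nu>\<close>, and
  \<open>[1]^q / [2] \<nu> \<beta>^q = e0 \<alpha>\<close>.
\<close>

section \<open>Values determined by the recurrences\<close>

lemma char_2_add_self: "CHAR('k) = 2 \<Longrightarrow> x + x = (0 :: 'k::comm_ring_1)"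
  by (metis mult_2 mult_zero_left of_nat_CHAR of_nat_numeral)

lemma char_2_add_swap: "CHAR('k) = 2 \<Longrightarrow> x = y + z \<Longrightarrow> y = x + (z :: 'k::comm_ring_1)"
  by (metis add.assoc add.right_neutral char_2_add_self)

text \<open>\<open>C n\<close> stands for the sum of \<open>1 / a^n\<close> over the nonzero
  polynomials \<open>a\<close> of degree below \<open>d\<close>, with
  \<open>\<beta> = e1 / e0\<close> and \<open>\<gamma> = e2 / e0\<close>. The value
  \<open>C 0 = 1\<close> absorbs the derivative term of Newton's identities, and
  \<open>n < q ^ 3 - 1\<close> keeps \<open>e3\<close> out.\<close>

locale zeta_recurrence =
  fixes q :: nat and C :: "nat \<Rightarrow> 'k::field" and \<beta> \<gamma> :: 'k
  assumes q_ge_2: "q \<ge> 2"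
    and C_0: "C 0 = 1"
    and C_double: "C (2 * n) = C n ^ 2"
    and C_frob: "C (q * n) = C n ^ q"
    and C_rec: "0 < n \<Longrightarrow> n < q ^ 3 - 1 \<Longrightarrow>
      C n = (if q - 1 \<le> n then \<beta> * C (n - (q - 1)) else 0)
          + (if q\<^sup>2 - 1 \<le> n then \<gamma> * C (n - (q\<^sup>2 - 1)) else 0)"
begin

text \<open>These exponents stay below \<open>q^2 - 1\<close>, so only the \<beta> term of the
  recurrence is present.\<close>

lemma C_mult_q_minus_1:
  assumes "k \<le> q"
  shows "C (k * (q - 1)) = \<beta> ^ k"
  using assms
proof (induction k)
  case 0
  then show ?case by (simp add: C_0)
next
  case (Suc k)
  have "Suc k * (q - 1) \<le> q * (q - 1)"
    using Suc.prems by (rule mult_right_mono) simp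
  moreover have "q * (q - 1) < q\<^sup>2 - 1"
    using q_ge_2 by (cases q) (auto simp: power2_eq_square algebra_simps)
  moreover have "q\<^sup>2 - 1 \<le> q ^ 3 - 1"
    using q_ge_2 by (intro diff_le_mono power_increasing) auto
  ultimately have "Suc k * (q - 1) < q\<^sup>2 - 1" "Suc k * (q - 1) < q ^ 3 - 1"
    by linarith+
  moreover have "0 < Suc k * (q - 1)" "q - 1 \<le> Suc k * (q - 1)"
      "Suc k * (q - 1) - (q - 1) = k * (q - 1)"
    using q_ge_2 by simp_all
  ultimately show ?case
    using C_rec[of "Suc k * (q - 1)"] Suc by simp
qed

text \<open>Here \<open>n = u (q^2 - 1) + v (q^2 - q)\<close>, written without subtraction. Taking
  \<open>q - 1\<close> off turns one summand \<open>q^2 - 1\<close> into \<open>q^2 - q\<close>, and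
  taking \<open>q^2 - 1\<close> off removes it, so each induction step yields the factor
  \<open>\<beta> * \<beta>^q + \<gamma>\<close>. For \<open>u = 0\<close> the value is a
  \<open>q\<close>-th power.\<close>

lemma C_product:
  assumes "u + v \<le> q" "n + u + v * q = (u + v) * q\<^sup>2"
  shows "C n = (\<beta> ^ (q + 1) + \<gamma>) ^ u * \<beta> ^ (q * v)"
  using assms
proof (induction u arbitrary: v n)
  case 0
  have "n = q * (v * (q - 1))"
    using 0 q_ge_2 by (simp add: power2_eq_square algebra_simps diff_mult_distrib2)
  then show ?case
    using C_mult_q_minus_1[of v] 0 by (simp add: C_frob flip: power_mult mult.commute)
next
  case (Suc u)
  have le: "u + v * q \<le> (u + v) * q\<^sup>2"
  proof -
    have "u * 1 + v * q \<le> u * q\<^sup>2 + v * q\<^sup>2"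
      using q_ge_2 by (intro add_mono mult_left_mono) (auto simp: power2_eq_square)
    then show ?thesis by (simp add: algebra_simps)
  qed
  have eq: "n + 1 + (u + v * q) = (u + v) * q\<^sup>2 + q\<^sup>2"
    using Suc.prems(2) by (simp add: algebra_simps)
  have ge2: "q\<^sup>2 - 1 \<le> n"
    using le eq by linarith
  have q2: "q < q\<^sup>2" "q\<^sup>2 < q ^ 3"
    using q_ge_2 by (auto simp: power2_eq_square power3_eq_cube)
  have ge1: "q - 1 \<le> n"
    using ge2 q2 by linarith
  \<comment> \<open>From \<open>n + 1 + (u + v * q) \<le> q^3\<close> the strict bound follows only
    if \<open>u + v * q > 0\<close>; otherwise \<open>n = q^2 - 1\<close>.\<close>
  have "n < q ^ 3 - 1"
  proof (cases "u + v * q = 0")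
    case True
    then have "u = 0" "v = 0" using q_ge_2 by auto
    then have "n + 1 = q\<^sup>2" using eq by simp
    then show ?thesis using q2 by linarith
  next
    case False
    have "(u + v) * q\<^sup>2 + q\<^sup>2 = (Suc u + v) * q\<^sup>2" by simp
    also have "\<dots> \<le> q * q\<^sup>2" using Suc.prems(1) by (rule mult_right_mono) simp
    also have "\<dots> = q ^ 3" by (simp add: power2_eq_square power3_eq_cube)
    finally show ?thesis using eq False by linarith
  qed
  moreover have "n > 0" using ge1 q_ge_2 by linarith
  moreover have "C (n - (q - 1)) = (\<beta> ^ (q + 1) + \<gamma>) ^ u * \<beta> ^ (q * Suc v)"
  proof (rule Suc.IH)
    show "u + Suc v \<le> q" using Suc.prems by simp
    have "n - (q - 1) + u + Suc v * q = n + 1 + (u + v * q)"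
      using ge1 q_ge_2 by simp
    then show "n - (q - 1) + u + Suc v * q = (u + Suc v) * q\<^sup>2"
      using eq by simp
  qed
  moreover have "C (n - (q\<^sup>2 - 1)) = (\<beta> ^ (q + 1) + \<gamma>) ^ u * \<beta> ^ (q * v)"
  proof (rule Suc.IH)
    show "u + v \<le> q" using Suc.prems by simp
    show "n - (q\<^sup>2 - 1) + u + v * q = (u + v) * q\<^sup>2"
      using eq ge2 q2 q_ge_2 by linarith
  qed
  ultimately show ?case
    using C_rec[of n] ge1 ge2 by (simp add: algebra_simps power_add)
qed

text \<open>The multiple \<open>2 (q - 1)\<close> of \<open>q - 1\<close> may exceed
  \<open>q\<close>, so this value comes from \<open>(q - 1)^2\<close> by the doubling rule.\<close>

lemma C_two_q_minus_1_square: "C (2 * (q - 1)\<^sup>2) = \<beta> ^ (2 * (q - 1))"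
proof -
  have "C ((q - 1) * (q - 1)) = \<beta> ^ (q - 1)"
    by (rule C_mult_q_minus_1) simp
  then show ?thesis
    by (metis C_double power2_eq_square power_mult mult.commute)
qed

text \<open>One step of the recurrence leads to the exponents \<open>2 (q - 1)^2\<close> and
  \<open>(q - 2) (q - 1)\<close>, where the values are known.\<close>

lemma C_q_minus_1_two_q_minus_1:
  "C ((q - 1) * (2 * q - 1)) = (\<beta> ^ (q + 1) + \<gamma>) * \<beta> ^ (q - 2)"
proof -
  obtain p where p: "q = p + 2" using q_ge_2 le_Suc_ex[of 2 q] by (metis add.commute)
  let ?n = "(q - 1) * (2 * q - 1)"
  have "?n < q ^ 3 - 1"
    unfolding p by (simp add: algebra_simps power3_eq_cube)
  moreover have "0 < ?n" "q - 1 \<le> ?n" "q\<^sup>2 - 1 \<le> ?n"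
    unfolding p by (simp_all add: algebra_simps power2_eq_square)
  moreover have "?n - (q - 1) = 2 * (q - 1)\<^sup>2" "?n - (q\<^sup>2 - 1) = (q - 2) * (q - 1)"
    unfolding p by (simp_all add: algebra_simps power2_eq_square)
  ultimately have "C ?n = \<beta> * \<beta> ^ (2 * (q - 1)) + \<gamma> * \<beta> ^ (q - 2)"
    using C_rec[of ?n] C_two_q_minus_1_square C_mult_q_minus_1[of "q - 2"] by simp
  also have "\<dots> = (\<beta> ^ (q + 1) + \<gamma>) * \<beta> ^ (q - 2)"
    unfolding p by (simp add: algebra_simps power_add mult_2_right)
  finally show ?thesis .
qed

end

text \<open>\<open>R n\<close> stands for \<open>S_d(n)\<close>. Up to \<open>n = q^2\<close> only
  \<open>e0\<close> and \<open>e1\<close> enter. The sum \<open>R 0\<close> never occurs, hence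
  \<open>2 \<le> n\<close> and the strict \<open>q < n\<close>.\<close>

locale power_sum_recurrence =
  fixes q :: nat and R :: "nat \<Rightarrow> 'k::field" and e0 e1 :: 'k
  assumes char_2: "CHAR('k) = 2"
    and q_ge_2: "q \<ge> 2" and e0_nonzero: "e0 \<noteq> 0"
    and R_1: "R 1 = e0"
    and R_double: "n > 0 \<Longrightarrow> R (2 * n) = R n ^ 2"
    and R_frob: "n > 0 \<Longrightarrow> R (q * n) = R n ^ q"
    and R_rec: "2 \<le> n \<Longrightarrow> n \<le> q\<^sup>2 \<Longrightarrow>
      R n = e0 * R (n - 1) + (if q < n then e1 * R (n - q) else 0)"
begin

lemmas add_swap = char_2_add_swap[OF char_2]

lemma q_le_square: "k \<le> q \<Longrightarrow> k * q \<le> q\<^sup>2"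
  by (simp add: power2_eq_square)

lemma R_small:
  assumes "0 < n" "n \<le> q"
  shows "R n = e0 ^ n"
  using assms
proof (induction n rule: nat_induct_non_zero)
  case 1
  show ?case using R_1 by simp
next
  case (Suc n)
  then show ?case
    using R_rec[of "Suc n"] q_le_square[of 1] q_ge_2 by simp
qed

lemma R_q_plus_1: "R (q + 1) = e0 * (e0 ^ q + e1)"
proof -
  have "q + 1 \<le> q\<^sup>2" using q_ge_2 by (simp add: power2_eq_square Suc_leI)
  then show ?thesis
    using R_rec[of "q + 1"] R_small[of q] R_small[of 1] q_ge_2 by (simp add: algebra_simps)
qed

text \<open>The recurrence at \<open>k * q\<close> is read backwards: \<open>R (k * q)\<close> and
  \<open>R (k * q - q)\<close> are \<open>q\<close>-th powers of known values, which leaves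
  \<open>R (k * q - 1)\<close> as the unknown.\<close>

lemma R_mult_q_minus_1:
  assumes "1 < k" "k \<le> q"
  shows "R (k * q - 1) = e0 ^ ((k - 1) * q - 1) * (e0 ^ q + e1)"
proof -
  obtain j where j: "k = Suc j" "j > 0" using assms(1) by (cases k) auto
  have "q < k * q" using assms q_ge_2 by simp
  moreover from this have "2 \<le> k * q" using q_ge_2 by linarith
  ultimately have "R (k * q) = e0 * R (k * q - 1) + e1 * R (k * q - q)"
    using R_rec[of "k * q"] q_le_square[OF assms(2)] by simp
  then have "e0 * R (k * q - 1) = R (k * q) + e1 * R (k * q - q)"
    by (rule add_swap)
  moreover have "R (k * q) = e0 ^ (k * q)"
    using R_frob[of k] R_small[of k] assms by (simp add: mult.commute power_mult)
  moreover have "R (k * q - q) = e0 ^ (j * q)"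
    using R_frob[of j] R_small[of j] assms j by (simp add: mult.commute power_mult)
  ultimately have "e0 * R (k * q - 1) = e0 ^ (j * q) * (e0 ^ q + e1)"
    unfolding j by (simp add: algebra_simps power_add)
  moreover have "e0 ^ (j * q) = e0 * e0 ^ (j * q - 1)"
    using j q_ge_2 by (simp flip: power_Suc)
  ultimately show ?thesis
    using e0_nonzero j by simp
qed

lemma R_product:
  assumes "u + v < q" "n + u + v * q = q\<^sup>2"
  shows "R n = e0 ^ q\<^sup>2 * ((e0 ^ q + e1) / e0 ^ (q + 1)) ^ u * (1 / e0 ^ q) ^ v"
  using assms
proof (induction u arbitrary: v n)
  case 0
  have "n = q * (q - v)"
    using 0 by (simp add: power2_eq_square diff_mult_distrib2 mult.commute)
  then have "R n = e0 ^ (q * (q - v))"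
    using R_frob[of "q - v"] R_small[of "q - v"] 0 by (simp add: mult.commute flip: power_mult)
  also have "\<dots> * e0 ^ (q * v) = e0 ^ q\<^sup>2"
    using 0 by (simp add: power2_eq_square flip: power_add add_mult_distrib2)
  then have "e0 ^ (q * (q - v)) = e0 ^ q\<^sup>2 / e0 ^ (q * v)"
    using e0_nonzero by (simp add: field_simps)
  finally show ?case
    by (simp add: power_divide power_mult)
next
  case (Suc u)
  have le: "Suc v * q + q \<le> q * q"
    using Suc.prems mult_right_mono[of "Suc (Suc v)" q q] by simp
  then have n: "n > 0" "n < q\<^sup>2" "q \<le> n"
    using Suc.prems by (simp_all add: power2_eq_square)
  \<comment> \<open>Each \<open>1\<close> taken off \<open>q^2\<close> contributes the factor \<mu>,
    each \<open>q\<close> taken off contributes \<nu>, which in this proof is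
    \<open>1 / e0^q\<close>. The recurrence at \<open>n + 1\<close>, solved for \<open>R n\<close>,
    then amounts to \<open>e0 * \<mu> = 1 + e1 * \<nu>\<close>.\<close>
  define \<mu> \<nu> where "\<mu> = (e0 ^ q + e1) / e0 ^ (q + 1)" and "\<nu> = 1 / e0 ^ q"
  have \<mu>: "e0 * \<mu> = 1 + e1 * \<nu>"
    using e0_nonzero by (simp add: \<mu>_def \<nu>_def field_simps)
  have "R (n + 1) = e0 ^ q\<^sup>2 * \<mu> ^ u * \<nu> ^ v"
    unfolding \<mu>_def \<nu>_def by (rule Suc.IH) (use Suc.prems in simp_all)
  moreover have "R (n + 1 - q) = e0 ^ q\<^sup>2 * \<mu> ^ u * \<nu> ^ Suc v"
    unfolding \<mu>_def \<nu>_def by (rule Suc.IH) (use Suc.prems n in simp_all)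
  moreover have "e0 * R n = R (n + 1) + e1 * R (n + 1 - q)"
    by (rule add_swap) (use R_rec[of "n + 1"] n in simp)
  ultimately have "e0 * R n = (1 + e1 * \<nu>) * (e0 ^ q\<^sup>2 * \<mu> ^ u * \<nu> ^ v)"
    by (simp add: algebra_simps)
  then have "e0 * R n = e0 * (e0 ^ q\<^sup>2 * \<mu> ^ Suc u * \<nu> ^ v)"
    using \<mu> by (simp add: mult_ac)
  then show ?case
    using e0_nonzero unfolding \<mu>_def \<nu>_def by (rule mult_left_cancel[THEN iffD1, rotated])
qed

text \<open>Taking off a \<open>q\<close> in place of a \<open>1\<close> exchanges one factor in
  \<open>R_product\<close>. This compares the first arguments in part (3) of the theorem.\<close>

lemma R_product_ratio:
  assumes "u + v + 1 < q" "n + Suc u + v * q = q\<^sup>2" "m + u + Suc v * q = q\<^sup>2"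
  shows "e0 * R n = (e0 ^ q + e1) * R m"
proof -
  have "R n = e0 ^ q\<^sup>2 * ((e0 ^ q + e1) / e0 ^ (q + 1)) ^ Suc u * (1 / e0 ^ q) ^ v"
    by (rule R_product) (use assms in simp_all)
  moreover have "R m = e0 ^ q\<^sup>2 * ((e0 ^ q + e1) / e0 ^ (q + 1)) ^ u * (1 / e0 ^ q) ^ Suc v"
    by (rule R_product) (use assms in simp_all)
  ultimately show ?thesis
    using e0_nonzero by simp
qed

end

section \<open>Power sums of roots\<close>

text \<open>Dividing by \<open>X - a\<close> means multiplying by the power series
  \<open>- sum_k X^k / a^(k + 1)\<close>; the claim compares the coefficients of
  \<open>X^n\<close>.\<close>

lemma coeff_linear_times_power_sum:
  fixes a :: "'k::field"
  assumes "a \<noteq> 0" and p: "p = [:- a, 1:] * r"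
  shows "(\<Sum>j\<le>n. coeff p j * (1 / a) ^ (n - j + 1)) = - coeff r n"
proof (induction n)
  case 0
  then show ?case using assms by simp
next
  case (Suc n)
  have "(\<Sum>j\<le>Suc n. coeff p j * (1 / a) ^ (Suc n - j + 1)) =
      (1 / a) * (\<Sum>j\<le>n. coeff p j * (1 / a) ^ (n - j + 1)) + coeff p (Suc n) / a"
    by (simp add: sum_distrib_left Suc_diff_le)
  also have "coeff p (Suc n) = coeff r n - a * coeff r (Suc n)"
    by (simp add: p)
  also have "(1 / a) * (\<Sum>j\<le>n. coeff p j * (1 / a) ^ (n - j + 1)) + \<dots> / a = - coeff r (Suc n)"
    unfolding Suc using assms(1) by (simp add: field_simps)
  finally show ?case .
qed

text \<open>
  Newton's identities for the reciprocals of the roots, from the logarithmic derivative of \<open>p\<close>.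
\<close>

lemma sum_coeff_power_sum_roots:
  fixes p :: "'k::field poly"
  assumes "finite S" "0 \<notin> S" "card S = degree p" "\<And>a. a \<in> S \<Longrightarrow> poly p a = 0"
  shows "(\<Sum>j\<le>n. coeff p j * (\<Sum>a\<in>S. (1 / a) ^ (n - j + 1))) = - coeff (pderiv p) n"
proof -
  define c where "c = lead_coeff p"
  define r where "r a = smult c (\<Prod>b\<in>S - {a}. [:- b, 1:])" for a
  \<comment> \<open>As \<open>S\<close> has \<open>degree p\<close> elements, \<open>p\<close>
    splits over it: both sides have the same leading coefficient and agree on
    \<open>S\<close>.\<close>
  have p: "p = smult c (\<Prod>a\<in>S. [:- a, 1:])"
  proof (rule poly_eqI_degree_lead_coeff[where A = S and n = "degree p"])
    have "degree (\<Prod>a\<in>S. [:- a, 1:]) = card S"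
      using assms(1) by (subst degree_prod_eq_sum_degree) auto
    moreover have "lead_coeff (\<Prod>a\<in>S. [:- a, 1:]) = 1"
      by (simp add: lead_coeff_prod)
    ultimately show "coeff p (degree p) = coeff (smult c (\<Prod>a\<in>S. [:- a, 1:])) (degree p)"
      "degree (smult c (\<Prod>a\<in>S. [:- a, 1:])) \<le> degree p"
      using assms by (auto simp: c_def)
  qed (use assms in \<open>auto simp: poly_prod\<close>)
  have pr: "p = [:- a, 1:] * r a" if "a \<in> S" for a
    using that assms(1) by (simp add: p r_def prod.remove)
  have "(\<Sum>j\<le>n. coeff p j * (\<Sum>a\<in>S. (1 / a) ^ (n - j + 1))) =
      (\<Sum>a\<in>S. \<Sum>j\<le>n. coeff p j * (1 / a) ^ (n - j + 1))"
    by (subst sum.swap) (simp add: sum_distrib_left)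
  also have "\<dots> = (\<Sum>a\<in>S. - coeff (r a) n)"
    using assms(2) pr by (intro sum.cong refl coeff_linear_times_power_sum) auto
  also have "\<dots> = - coeff (\<Sum>a\<in>S. r a) n"
    by (simp add: coeff_sum sum_negf)
  also have "(\<Sum>a\<in>S. r a) = pderiv p"
    by (simp add: p r_def pderiv_smult pderiv_prod pderiv_pCons sum_distrib_left[of "[:c:]", simplified])
  finally show ?thesis .
qed

section \<open>Carlitz polynomials in characteristic 2\<close>

text \<open>\<open>t\<close> will be the variable of \<open>A\<close>. The last assumption makes the
  brackets \<open>[n]\<close> nonzero; they are the denominators in the Carlitz polynomials.\<close>

locale carlitz =
  fixes t :: "'k::field" and q e :: nat
  assumes char_2: "CHAR('k) = 2"
    and q_eq: "q = 2 ^ e" and e_pos: "e > 0"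
    and power_t_neq: "n > 0 \<Longrightarrow> t ^ (q ^ n) \<noteq> t"
begin

lemma q_ge_2: "q \<ge> 2"
  using e_pos q_eq by (cases e) auto

lemma two_eq_0: "(2 :: 'k) = 0"
  using char_2 by (metis of_nat_CHAR of_nat_numeral)

lemmas add_self = char_2_add_self[OF char_2]

lemmas add_swap = char_2_add_swap[OF char_2]

lemma minus_eq_self: "- x = (x :: 'k)"
  by (metis add_self minus_unique)

lemma diff_eq_add: "x - y = x + (y :: 'k)"
  by (metis diff_conv_add_uminus minus_eq_self)

lemma add_power_q: "(x + y :: 'k) ^ q = x ^ q + y ^ q"
  using freshmans_dream'[of q e x y] char_2 q_eq by simp

lemma add_power_q_power: "(x + y :: 'k) ^ (q ^ i) = x ^ (q ^ i) + y ^ (q ^ i)"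
  using freshmans_dream'[of "q ^ i" "e * i" x y] char_2 q_eq by (simp add: power_mult)

lemma sum_power_q: "sum f A ^ q = (\<Sum>i\<in>A. f i ^ q :: 'k)"
  using freshmans_dream_sum'[of q e f A] char_2 q_eq by simp

lemma sum_square: "sum f A ^ 2 = (\<Sum>i\<in>A. f i ^ 2 :: 'k)"
  by (rule freshmans_dream_sum) (simp_all add: char_2)

lemma of_nat_q_power: "n > 0 \<Longrightarrow> of_nat (q ^ n) = (0 :: 'k)"
  using e_pos two_eq_0 by (simp add: q_eq power_0_left)

text \<open>The bracket \<open>[n]\<close>; in characteristic 2 the sign is immaterial.\<close>

definition br :: "nat \<Rightarrow> 'k" where
  "br n = t ^ (q ^ n) + t"

lemma br_nonzero: "n > 0 \<Longrightarrow> br n \<noteq> 0"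
  using power_t_neq[of n] add_swap[of 0 "t ^ (q ^ n)" t] by (auto simp: br_def)

lemma br_0 [simp]: "br 0 = 0"
  by (simp add: br_def add_self)

lemma br_power_q: "br n ^ q = br (Suc n) + br 1"
proof -
  have "br n ^ q = t ^ (q ^ Suc n) + t ^ q"
    by (simp add: br_def add_power_q mult.commute flip: power_mult)
  also have "\<dots> = br (Suc n) + br 1"
    using add_self[of t] by (simp add: br_def algebra_simps)
  finally show ?thesis .
qed

text \<open>
  \<open>eps d x\<close> is the binomial of Carlitz: the \<open>F_q\<close>-linear polynomial that vanishes on the
  polynomials of degree less than \<open>d\<close> in \<open>t\<close> and is \<open>1\<close> on the monic ones of degree \<open>d\<close>.
\<close>

primrec coef :: "nat \<Rightarrow> nat \<Rightarrow> 'k" where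
  "coef 0 i = (if i = 0 then 1 else 0)"
| "coef (Suc d) i = ((if i = 0 then 0 else coef d (i - 1) ^ q) + coef d i) / br (Suc d)"

definition eps :: "nat \<Rightarrow> 'k \<Rightarrow> 'k" where
  "eps d x = (\<Sum>i\<le>d. coef d i * x ^ (q ^ i))"

lemma coef_eq_0: "d < i \<Longrightarrow> coef d i = 0"
  using q_ge_2 by (induction d arbitrary: i) auto

lemma coef_diag_nonzero: "coef d d \<noteq> 0"
  by (induction d) (auto simp: coef_eq_0 br_nonzero)

lemma coef_0_nonzero: "coef d 0 \<noteq> 0"
  by (induction d) (auto simp: br_nonzero)

text \<open>In the induction, \<open>[d]^q + [1] = [d + 1]\<close> cancels the denominator of the
  recursion for \<open>coef\<close>.\<close>

lemma coef_1: "br 1 * coef d 1 = (br d * coef d 0) ^ q"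
proof (induction d)
  case 0
  then show ?case using q_ge_2 by simp
next
  case (Suc d)
  have "br 1 * coef (Suc d) 1 = (br 1 * coef d 0 ^ q + br 1 * coef d 1) / br (Suc d)"
    by (simp add: field_simps)
  also have "\<dots> = (br 1 + br d ^ q) * coef d 0 ^ q / br (Suc d)"
    unfolding Suc by (simp add: algebra_simps power_mult_distrib)
  also have "br 1 + br d ^ q = br (Suc d)"
    using add_self[of "br 1"] by (simp add: br_power_q algebra_simps)
  finally show ?case
    using br_nonzero[of "Suc d"] by simp
qed

lemma coef_1_Suc: "br 1 * coef (Suc d) 1 = coef d 0 ^ q"
  using coef_1[of "Suc d"] br_nonzero[of "Suc d"] by simp

lemma coef_2: "br 2 * coef d 2 = ((br d + br 1) * coef d 1) ^ q"
proof (induction d)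
  case 0
  then show ?case using q_ge_2 by simp
next
  case (Suc d)
  have "br 2 * coef (Suc d) 2 = (br 2 * coef d 1 ^ q + br 2 * coef d 2) / br (Suc d)"
    by (simp add: field_simps numeral_2_eq_2)
  also have "\<dots> = (br 2 + br d ^ q + br 1 ^ q) * coef d 1 ^ q / br (Suc d)"
    unfolding Suc by (simp add: algebra_simps power_mult_distrib add_power_q)
  also have "br 2 + br d ^ q + br 1 ^ q = br (Suc d)"
    by (simp add: br_power_q two_eq_0 algebra_simps flip: numeral_2_eq_2 One_nat_def)
  also have "br (Suc d) * coef d 1 ^ q / br (Suc d) = coef d 1 ^ q"
    using br_nonzero[of "Suc d"] by simp
  \<comment> \<open>The coefficient has to be moved from level \<open>d\<close> to level
    \<open>d + 1\<close>; at both levels it is a multiple of the \<open>q\<close>-th power of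
    \<open>coef d 0\<close>.\<close>
  also have "coef d 1 = (br (Suc d) + br 1) * coef (Suc d) 1"
  proof -
    have "br 1 * coef d 1 = br d ^ q * coef d 0 ^ q"
      using coef_1[of d] by (simp add: power_mult_distrib)
    also have "\<dots> = br 1 * ((br (Suc d) + br 1) * coef (Suc d) 1)"
      by (simp only: br_power_q mult_ac flip: coef_1_Suc)
    finally show ?thesis using br_nonzero[of 1] by (simp del: coef.simps)
  qed
  finally show ?case .
qed

text \<open>The identity behind every ratio \<open>[1]^q / [2]\<close> of the theorem.\<close>

lemma coef_ratio:
  fixes d
  defines "e0 \<equiv> coef d 0" and "e1 \<equiv> coef d 1" and "e2 \<equiv> coef d 2"
  shows "br 1 ^ q / br 2 * (e0 ^ q + e1) * (e1 / e0) ^ q = e0 * ((e1 / e0) ^ (q + 1) + e2 / e0)"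
proof -
  have e0: "e0 \<noteq> 0" unfolding e0_def by (rule coef_0_nonzero)
  have 1: "br 1 * e1 = br d ^ q * e0 ^ q"
    unfolding e0_def e1_def by (simp only: coef_1 power_mult_distrib)
  have 2: "br 2 * e2 = (br d ^ q + br 1 ^ q) * e1 ^ q"
    unfolding e1_def e2_def by (simp only: coef_2 power_mult_distrib add_power_q)
  have 3: "br 2 = br 1 ^ q + br 1"
    using br_power_q[of 1] by (simp add: two_eq_0 algebra_simps numeral_2_eq_2)
  have "br 2 * e1 ^ (q + 1) + br 2 * e2 * e0 ^ q =
      (br 1 ^ q * e1 + br 1 * e1 + br d ^ q * e0 ^ q + br 1 ^ q * e0 ^ q) * e1 ^ q"
    unfolding 2 by (simp add: 3 algebra_simps)
  \<comment> \<open>The terms \<open>[1] e1\<close> and \<open>[d]^q e0^q\<close> are equal and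
    cancel in characteristic 2.\<close>
  also have "\<dots> = br 1 ^ q * (e0 ^ q + e1) * e1 ^ q"
    unfolding 1 by (simp add: two_eq_0 algebra_simps flip: mult_2)
  finally have "br 1 ^ q * (e0 ^ q + e1) * e1 ^ q / (br 2 * e0 ^ q) =
      (br 2 * e1 ^ (q + 1) + br 2 * e2 * e0 ^ q) / (br 2 * e0 ^ q)"
    by simp
  also have "\<dots> = e0 * ((e1 / e0) ^ (q + 1) + e2 / e0)"
    using e0 br_nonzero[of 2] by (simp add: field_simps)
  finally show ?thesis
    by (simp add: power_divide)
qed

text \<open>The recursion for \<open>coef\<close> is this identity read coefficientwise: taking
  \<open>q\<close>-th powers shifts the index by one.\<close>

lemma eps_Suc: "eps (Suc d) x = (eps d x ^ q + eps d x) / br (Suc d)"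
proof -
  have "eps d x ^ q = (\<Sum>i\<le>d. coef d i ^ q * x ^ (q ^ Suc i))"
    by (simp add: eps_def sum_power_q power_mult_distrib mult.commute flip: power_mult)
  also have "\<dots> = (\<Sum>i\<le>Suc d. (if i = 0 then 0 else coef d (i - 1) ^ q) * x ^ (q ^ i))"
    by (subst sum.atMost_Suc_shift) simp
  finally have 1: "eps d x ^ q = \<dots>" .
  have 2: "eps d x = (\<Sum>i\<le>Suc d. coef d i * x ^ (q ^ i))"
    by (simp add: eps_def coef_eq_0)
  show ?thesis
    by (subst 1, subst 2)
       (simp add: eps_def sum_divide_distrib add_divide_distrib algebra_simps
         del: sum.atMost_Suc flip: sum.distrib)
qed

lemma eps_0 [simp]: "eps 0 x = x"
  by (simp add: eps_def)

lemma eps_add: "eps d (x + y) = eps d x + eps d y"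
  by (simp add: eps_def add_power_q_power sum.distrib algebra_simps)

lemma eps_zero_right [simp]: "eps d 0 = 0"
  using q_ge_2 by (induction d) (simp_all add: eps_Suc)

lemma eps_const: "c ^ q = c \<Longrightarrow> eps (Suc d) c = 0"
proof (induction d)
  case 0
  then show ?case by (simp add: eps_Suc add_self)
next
  case (Suc d)
  then show ?case using q_ge_2 by (subst eps_Suc) simp
qed

text \<open>Together with \<open>eps_add\<close> and \<open>eps_const\<close> this evaluates
  \<open>eps\<close> at a polynomial in \<open>t\<close>, one coefficient at a time.\<close>

lemma eps_t_mult: "eps (Suc d) (t * x) = t * eps (Suc d) x + eps d x ^ q"
proof (induction d)
  case 0
  have "br 1 * eps 1 (t * x) = (t * x) ^ q + t * x"
    using br_nonzero[of 1] by (simp add: eps_Suc)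
  also have "\<dots> = t * (x ^ q + x) + br 1 * x ^ q"
    by (simp add: br_def two_eq_0 algebra_simps power_mult_distrib)
  also have "x ^ q + x = br 1 * eps 1 x"
    using br_nonzero[of 1] by (simp add: eps_Suc)
  finally have "br 1 * eps 1 (t * x) = br 1 * (t * eps 1 x + eps 0 x ^ q)"
    by (simp add: algebra_simps)
  then show ?case
    using br_nonzero[of 1] by simp
next
  case (Suc d)
  have "eps (Suc (Suc d)) (t * x) * br (Suc (Suc d)) =
     (t * eps (Suc d) x + eps d x ^ q) ^ q + (t * eps (Suc d) x + eps d x ^ q)"
    using br_nonzero[of "Suc (Suc d)"] Suc by (subst eps_Suc) simp
  also have "\<dots> = t ^ q * eps (Suc d) x ^ q + t * eps (Suc d) x + (eps d x ^ q + eps d x) ^ q"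
    by (simp add: add_power_q power_mult_distrib algebra_simps)
  also have "(eps d x ^ q + eps d x) = br (Suc d) * eps (Suc d) x"
    using br_nonzero[of "Suc d"] by (simp add: eps_Suc)
  also have "(br (Suc d) * eps (Suc d) x) ^ q = (br (Suc (Suc d)) + br 1) * eps (Suc d) x ^ q"
    by (simp add: power_mult_distrib br_power_q)
  also have "t ^ q * eps (Suc d) x ^ q + t * eps (Suc d) x + \<dots> =
      t * (eps (Suc d) x ^ q + eps (Suc d) x) + br (Suc (Suc d)) * eps (Suc d) x ^ q"
  proof -
    have "t ^ q + br 1 = t"
      using add_self[of "t ^ q"] by (simp add: br_def algebra_simps)
    then have "(t ^ q + br 1) * eps (Suc d) x ^ q = t * eps (Suc d) x ^ q" by simp
    then show ?thesis by (simp add: algebra_simps)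
  qed
  also have "eps (Suc d) x ^ q + eps (Suc d) x = br (Suc (Suc d)) * eps (Suc (Suc d)) x"
    using br_nonzero[of "Suc (Suc d)"] by (simp add: eps_Suc[of "Suc d"])
  finally have "br (Suc (Suc d)) * eps (Suc (Suc d)) (t * x) =
      br (Suc (Suc d)) * (t * eps (Suc (Suc d)) x + eps (Suc d) x ^ q)"
    by (simp add: algebra_simps)
  then show ?case
    using br_nonzero[of "Suc (Suc d)"] by simp
qed

end

section \<open>Newton's identities for the Carlitz polynomials\<close>

context carlitz
begin

text \<open>Since \<open>coef d i = 0\<close> for \<open>i > d\<close>, small \<open>d\<close> is no
  exception, and the recurrences have one shape for all \<open>d\<close>.\<close>

lemma sum_coef_bounded:
  assumes "\<And>i. k \<le> i \<Longrightarrow> h i = 0"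
  shows "(\<Sum>i\<le>d. coef d i * h i) = (\<Sum>i<k. coef d i * h i)"
  by (rule sum.mono_neutral_cong) (use assms coef_eq_0 in \<open>auto simp: not_le not_less\<close>)

lemma q_power_le_iff: "q ^ i \<le> q ^ j \<longleftrightarrow> i \<le> j"
  using q_ge_2 by (intro power_increasing_iff) auto

text \<open>
  With \<open>s = 0\<close> and \<open>s = 1\<close> these are \<open>eps d\<close> and its quotient by the variable, as polynomials.
\<close>

definition eps_poly :: "nat \<Rightarrow> nat \<Rightarrow> 'k poly" where
  "eps_poly s d = (\<Sum>i\<le>d. monom (coef d i) (q ^ i - s))"

lemma coeff_eps_poly: "coeff (eps_poly s d) j = (\<Sum>i\<le>d. if q ^ i - s = j then coef d i else 0)"
  by (simp add: eps_poly_def coeff_sum)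

lemma poly_eps_poly: "poly (eps_poly 0 d) x = eps d x"
  by (simp add: eps_poly_def eps_def poly_sum poly_monom)

lemma poly_eps_poly_1: "x * poly (eps_poly 1 d) x = eps d x"
proof -
  have "x * x ^ (q ^ i - 1) = x ^ (q ^ i)" for i
    using q_ge_2 by (simp flip: power_Suc)
  then have "x * (coef d i * x ^ (q ^ i - 1)) = coef d i * x ^ (q ^ i)" for i
    by (metis mult.left_commute)
  then show ?thesis
    by (simp only: eps_poly_def eps_def poly_sum poly_monom sum_distrib_left)
qed

lemma degree_eps_poly:
  assumes "s \<le> 1"
  shows "degree (eps_poly s d) = q ^ d - s"
proof (rule antisym)
  show "degree (eps_poly s d) \<le> q ^ d - s"
    unfolding eps_poly_def
  proof (intro degree_sum_le)
    fix i assume "i \<in> {..d}"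
    then have "q ^ i - s \<le> q ^ d - s" by (intro diff_le_mono) (simp add: q_power_le_iff)
    then show "degree (monom (coef d i) (q ^ i - s)) \<le> q ^ d - s"
      using degree_monom_le[of "coef d i" "q ^ i - s"] by linarith
  qed simp
  have "q ^ i - s = q ^ d - s \<longleftrightarrow> i = d" for i
  proof -
    have "q ^ i \<ge> 1" "q ^ d \<ge> 1" using q_ge_2 by (simp_all add: Suc_leI)
    then have "q ^ i - s = q ^ d - s \<longleftrightarrow> q ^ i = q ^ d" using assms by linarith
    then show ?thesis using q_ge_2 by (simp add: power_inject_exp)
  qed
  then have "coeff (eps_poly s d) (q ^ d - s) \<noteq> 0"
    by (simp add: coeff_eps_poly coef_diag_nonzero)
  then show "q ^ d - s \<le> degree (eps_poly s d)" by (rule le_degree)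
qed

lemma sum_coeff_eps_poly:
  "(\<Sum>j\<le>n. coeff (eps_poly s d) j * g j) =
   (\<Sum>i\<le>d. coef d i * (if q ^ i - s \<le> n then g (q ^ i - s) else 0))"
proof -
  have "(\<Sum>j\<le>n. coeff (eps_poly s d) j * g j) =
      (\<Sum>i\<le>d. \<Sum>j\<le>n. if q ^ i - s = j then coef d i * g j else 0)"
    by (subst sum.swap) (auto simp: coeff_eps_poly sum_distrib_right intro!: sum.cong)
  also have "\<dots> = (\<Sum>i\<le>d. coef d i * (if q ^ i - s \<le> n then g (q ^ i - s) else 0))"
    by (auto intro!: sum.cong)
  finally show ?thesis .
qed

text \<open>By its size, \<open>S\<close> is the full set of roots of \<open>eps d - 1\<close>. The
  derivative of this polynomial is the constant \<open>e0\<close>, because \<open>q^i\<close> is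
  zero in the field for \<open>i > 0\<close>, so Newton's identities become a linear
  recurrence.\<close>

lemma power_sum_recurrence_level_set:
  assumes "finite S" "card S = q ^ d" and S: "\<And>a. a \<in> S \<Longrightarrow> eps d a = 1"
  shows "power_sum_recurrence q (\<lambda>n. \<Sum>a\<in>S. (1 / a) ^ n) (coef d 0) (coef d 1)"
proof -
  define R where "R n = (\<Sum>a\<in>S. (1 / a) ^ n)" for n
  define p where "p = eps_poly 0 d - 1"
  have "0 \<notin> S" using S by force
  have degree_p: "degree p = q ^ d"
    using degree_add_eq_left[of "- 1" "eps_poly 0 d"] q_ge_2 by (simp add: p_def degree_eps_poly)
  have "coeff (pderiv p) n = (if n = 0 then coef d 0 else 0)" for n
  proof -
    have "coeff (pderiv p) n = of_nat (Suc n) * (\<Sum>i\<le>d. if q ^ i = Suc n then coef d i else 0)"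
      by (simp add: p_def coeff_pderiv coeff_eps_poly)
    also have "\<dots> = (\<Sum>i\<le>d. if i = 0 \<and> n = 0 then coef d 0 else 0)"
      unfolding sum_distrib_left
    proof (rule sum.cong[OF refl])
      fix i
      have "of_nat (Suc n) = (0 :: 'k)" if "q ^ i = Suc n" "i \<noteq> 0"
        using of_nat_q_power[of i] that by (metis gr0I)
      then show "of_nat (Suc n) * (if q ^ i = Suc n then coef d i else 0) =
          (if i = 0 \<and> n = 0 then coef d 0 else 0)"
        by (cases "i = 0") (auto simp del: of_nat_Suc simp flip: One_nat_def)
    qed
    also have "\<dots> = (if n = 0 then coef d 0 else 0)"
      by (cases "n = 0") simp_all
    finally show ?thesis .
  qed
  then have newton: "(\<Sum>j\<le>n. coeff p j * R (n - j + 1)) = (if n = 0 then coef d 0 else 0)" for n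
    using sum_coeff_power_sum_roots[of S p n] assms \<open>0 \<notin> S\<close> degree_p
    by (simp add: R_def p_def poly_eps_poly minus_eq_self)
  \<comment> \<open>Moving the constant coefficient of \<open>eps d - 1\<close> to the right
    isolates \<open>R (n + 1)\<close>.\<close>
  have rec: "(\<Sum>i\<le>d. coef d i * (if q ^ i \<le> n then R (n + 1 - q ^ i) else 0)) =
      R (n + 1) + (if n = 0 then coef d 0 else 0)" for n
  proof -
    have "(\<Sum>i\<le>d. coef d i * (if q ^ i \<le> n then R (n - q ^ i + 1) else 0)) =
        (\<Sum>j\<le>n. (coeff p j + coeff 1 j) * R (n - j + 1))"
      using sum_coeff_eps_poly[of 0 d "\<lambda>j. R (n - j + 1)" n] by (simp add: p_def cong: if_cong)
    also have "\<dots> = (if n = 0 then coef d 0 else 0) + R (n + 1)"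
      unfolding distrib_right sum.distrib newton
      by (simp add: sum.atMost_shift)
    finally show ?thesis
      by (simp add: Suc_diff_le add.commute cong: if_cong)
  qed
  show ?thesis
    unfolding R_def[symmetric]
  proof
    show "R 1 = coef d 0"
    proof -
      have "(\<Sum>i\<le>d. coef d i * (if q ^ i \<le> 0 then R (0 + 1 - q ^ i) else 0)) = 0"
        using q_ge_2 by (intro sum.neutral) auto
      then show ?thesis using rec[of 0] add_swap[of 0 "R 1"] by simp
    qed
    show "R (2 * n) = R n ^ 2" for n
      by (simp add: R_def sum_square flip: power_mult mult.commute)
    show "R (q * n) = R n ^ q" for n
      by (simp add: R_def sum_power_q flip: power_mult mult.commute)
    fix n assume n: "2 \<le> n" "n \<le> q\<^sup>2"
    have "R n = (\<Sum>i\<le>d. coef d i * (if q ^ i \<le> n - 1 then R (n - q ^ i) else 0))"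
      using rec[of "n - 1"] n by (simp cong: if_cong)
    also have "\<dots> = (\<Sum>i<2. coef d i * (if q ^ i \<le> n - 1 then R (n - q ^ i) else 0))"
    proof (rule sum_coef_bounded)
      fix i :: nat assume "2 \<le> i"
      then have "q\<^sup>2 \<le> q ^ i" by (simp add: q_power_le_iff)
      then show "(if q ^ i \<le> n - 1 then R (n - q ^ i) else 0) = 0" using n by simp
    qed
    also have "\<dots> = coef d 0 * R (n - 1) + (if q < n then coef d 1 * R (n - q) else 0)"
      using n by (auto simp: numeral_2_eq_2)
    finally show "R n = \<dots>" .
  qed (use char_2 q_ge_2 coef_0_nonzero in auto)
qed

text \<open>Newton's identities for \<open>eps d x / x\<close>, whose roots are the nonzero elements
  of \<open>S\<close>.\<close>

lemma zeta_recurrence_kernel: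
  assumes "finite S" "card S = q ^ d" "0 \<in> S" and S: "\<And>a. a \<in> S \<Longrightarrow> eps d a = 0"
  shows "zeta_recurrence q (\<lambda>n. if n = 0 then 1 else \<Sum>a\<in>S - {0}. (1 / a) ^ n)
    (coef d 1 / coef d 0) (coef d 2 / coef d 0)"
proof -
  define C where "C n = (if n = 0 then 1 else \<Sum>a\<in>S - {0}. (1 / a) ^ n)" for n
  define r where "r = eps_poly 1 d"
  have newton: "(\<Sum>j\<le>n. coeff r j * (\<Sum>a\<in>S - {0}. (1 / a) ^ (n - j + 1))) = coeff (pderiv r) n" for n
  proof -
    have "(\<Sum>j\<le>n. coeff r j * (\<Sum>a\<in>S - {0}. (1 / a) ^ (n - j + 1))) = - coeff (pderiv r) n"
    proof (rule sum_coeff_power_sum_roots)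
      show "card (S - {0}) = degree r"
        using assms by (simp add: r_def degree_eps_poly)
      fix a assume "a \<in> S - {0}"
      then show "poly r a = 0"
        using S[of a] poly_eps_poly_1[of a d] by (simp add: r_def)
    qed (use assms in auto)
    then show ?thesis by (simp add: minus_eq_self)
  qed
  \<comment> \<open>The exponents \<open>q^i - 1\<close> with \<open>i > 0\<close> equal 1 in a
    field of characteristic 2, so differentiating only shifts the coefficients.\<close>
  have deriv: "coeff (pderiv r) n = coeff r (Suc n)" for n
  proof -
    have "coeff (pderiv r) n = (\<Sum>i\<le>d. of_nat (Suc n) * (if q ^ i - 1 = Suc n then coef d i else 0))"
      by (simp add: r_def coeff_pderiv coeff_eps_poly sum_distrib_left)
    also have "\<dots> = (\<Sum>i\<le>d. if q ^ i - 1 = Suc n then coef d i else 0)"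
    proof (rule sum.cong[OF refl])
      fix i
      have "of_nat (Suc n) = (1 :: 'k)" if "q ^ i - 1 = Suc n"
      proof -
        have "i > 0" using that by (cases i) auto
        moreover have "q ^ i = Suc n + 1" using that by linarith
        ultimately have "0 = of_nat (Suc n) + (1 :: 'k)"
          using of_nat_q_power[of i] by (metis of_nat_add of_nat_1)
        then have "of_nat (Suc n) = 0 + (1 :: 'k)" by (rule add_swap)
        then show ?thesis by simp
      qed
      then show "of_nat (Suc n) * (if q ^ i - 1 = Suc n then coef d i else 0) =
          (if q ^ i - 1 = Suc n then coef d i else 0)" by auto
    qed
    finally show ?thesis by (simp add: r_def coeff_eps_poly)
  qed
  have rec: "(\<Sum>i\<le>d. coef d i * (if q ^ i - 1 \<le> n then C (n - (q ^ i - 1)) else 0)) = 0"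
    if "n > 0" for n
  proof -
    obtain k where k: "n = Suc k" using \<open>n > 0\<close> gr0_conv_Suc by blast
    have "(\<Sum>i\<le>d. coef d i * (if q ^ i - 1 \<le> n then C (n - (q ^ i - 1)) else 0)) =
        (\<Sum>j\<le>Suc k. coeff r j * C (Suc k - j))"
      unfolding r_def k by (rule sum_coeff_eps_poly[symmetric])
    \<comment> \<open>The term \<open>j = k + 1\<close> is split off with \<open>C 0 = 1\<close>. By
      Newton's identity it equals the rest, and the two cancel.\<close>
    also have "\<dots> = (\<Sum>j\<le>k. coeff r j * (\<Sum>a\<in>S - {0}. (1 / a) ^ (k - j + 1))) + coeff r (Suc k)"
      by (simp add: C_def Suc_diff_le)
    also have "\<dots> = 0"
      unfolding newton deriv by (rule add_self)
    finally show ?thesis .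
  qed
  show ?thesis
    unfolding C_def[symmetric]
  proof
    show "C 0 = 1" by (simp add: C_def)
    show "C (2 * n) = C n ^ 2" for n
      by (simp add: C_def sum_square flip: power_mult mult.commute)
    show "C (q * n) = C n ^ q" for n
      using q_ge_2 by (simp add: C_def sum_power_q flip: power_mult mult.commute)
    fix n assume n: "0 < n" "n < q ^ 3 - 1"
    let ?h = "\<lambda>i. if q ^ i - 1 \<le> n then C (n - (q ^ i - 1)) else 0"
    have "0 = (\<Sum>i\<le>d. coef d i * ?h i)"
      using rec[of n] n by simp
    also have "\<dots> = (\<Sum>i<3. coef d i * ?h i)"
    proof (rule sum_coef_bounded)
      fix i :: nat assume "3 \<le> i"
      then have "q ^ 3 \<le> q ^ i" by (simp add: q_power_le_iff)
      then show "?h i = 0" using n by simp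
    qed
    also have "\<dots> = coef d 0 * C n + (coef d 1 * ?h 1 + coef d 2 * ?h 2)"
      by (simp add: numeral_3_eq_3 numeral_2_eq_2)
    finally have "coef d 0 * C n = 0 + (coef d 1 * ?h 1 + coef d 2 * ?h 2)"
      by (rule add_swap)
    then have "C n = coef d 1 / coef d 0 * ?h 1 + coef d 2 / coef d 0 * ?h 2"
      using coef_0_nonzero[of d] by (simp add: field_simps)
    then show "C n = (if q - 1 \<le> n then coef d 1 / coef d 0 * C (n - (q - 1)) else 0) +
        (if q\<^sup>2 - 1 \<le> n then coef d 2 / coef d 0 * C (n - (q\<^sup>2 - 1)) else 0)"
      by simp
  qed (use q_ge_2 in auto)
qed

end

section \<open>Power sums of monic polynomials\<close>

unbundle fps_syntax

lemma fls_eqI: "(\<And>n. f $$ n = g $$ n) \<Longrightarrow> f = g"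
  by (simp add: fls_eq_iff)

lemma to_K_inf_pCons: "to_K_inf (pCons c p) = fls_const c + fls_X_inv * to_K_inf p"
  by (simp add: to_K_inf_def map_poly_pCons)

lemma to_K_inf_0 [simp]: "to_K_inf 0 = 0"
  by (simp add: to_K_inf_def)

lemma to_K_inf_diff: "to_K_inf (p - r) = to_K_inf p - to_K_inf r"
  by (rule fls_eqI) (simp add: to_K_inf_nth)

lemma to_K_inf_smult: "to_K_inf (smult c p) = fls_const c * to_K_inf p"
  by (rule fls_eqI) (simp add: to_K_inf_nth)

lemma inj_to_K_inf: "inj to_K_inf"
proof (rule injI)
  fix p r :: "'a::field poly" assume "to_K_inf p = to_K_inf r"
  then have "to_K_inf p $$ (- int n) = to_K_inf r $$ (- int n)" for n by simp
  then show "p = r" by (intro poly_eqI) (simp add: to_K_inf_nth)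
qed

lemma to_K_inf_eq_0_iff [simp]: "to_K_inf p = 0 \<longleftrightarrow> p = 0"
  using inj_to_K_inf to_K_inf_0 by (metis injD)

lemma to_K_inf_X_power: "to_K_inf ([:0, 1:] ^ n) = fls_X_inv ^ n"
  by (induction n) (simp_all add: to_K_inf_pCons one_pCons)

lemma to_K_inf_bracket:
  "to_K_inf (bracket n :: 'a::finite_field poly) = fls_X_inv ^ (CARD('a) ^ n) - fls_X_inv"
  using to_K_inf_X_power[where ?'a = 'a, of 1]
  by (simp add: bracket_def to_K_inf_diff to_K_inf_X_power)

unbundle no fps_syntax

text \<open>The shift by 1 permutes the field and so leaves the sum of all its elements
  unchanged.\<close>

lemma of_nat_card_eq_0: "of_nat CARD('a) = (0 :: 'a::finite_field)"
proof -
  have "bij (\<lambda>x. x + 1 :: 'a)"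
    by (rule bij_betwI[where g = "\<lambda>x. x - 1"]) auto
  then have "(\<Sum>x\<in>UNIV. x + 1 :: 'a) = (\<Sum>x\<in>UNIV. x)"
    by (rule sum.reindex_bij_betw)
  then show ?thesis
    by (simp add: sum.distrib)
qed

definition monics :: "nat \<Rightarrow> 'a::finite_field poly set" where
  "monics d = {p. degree p = d \<and> lead_coeff p = 1}"

definition monics_below :: "nat \<Rightarrow> 'a::finite_field poly set" where
  "monics_below d = {p. degree p < d \<and> lead_coeff p = 1}"

text \<open>The zero polynomial is listed apart because its degree is \<open>0\<close>, so that the
  bound alone would exclude it for \<open>d = 0\<close>.\<close>

definition polys_below :: "nat \<Rightarrow> 'a::finite_field poly set" where
  "polys_below d = {p. p = 0 \<or> degree p < d}"

definition S_power_sum :: "nat \<Rightarrow> nat \<Rightarrow> 'a::finite_field fls" where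
  "S_power_sum d n = (\<Sum>p\<in>monics d. (1 / to_K_inf p) ^ n)"

definition S_power_sum_below :: "nat \<Rightarrow> nat \<Rightarrow> 'a::finite_field fls" where
  "S_power_sum_below d n = (\<Sum>p\<in>monics_below d. (1 / to_K_inf p) ^ n)"

lemma polys_below_card:
  "finite (polys_below d :: 'a::finite_field poly set) \<and>
   card (polys_below d :: 'a poly set) = CARD('a) ^ d"
proof (induction d)
  case 0
  have "polys_below 0 = {0 :: 'a poly}" by (auto simp: polys_below_def)
  then show ?case by simp
next
  case (Suc d)
  have "(polys_below (Suc d) :: 'a poly set) = (\<lambda>(c, p). pCons c p) ` (UNIV \<times> polys_below d)"
  proof (intro equalityI subsetI)
    fix p :: "'a poly" assume p: "p \<in> polys_below (Suc d)"
    obtain c r where pr: "p = pCons c r" by (cases p) auto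
    then have "r \<in> polys_below d" using p by (auto simp: polys_below_def split: if_splits)
    then show "p \<in> (\<lambda>(c, p). pCons c p) ` (UNIV \<times> polys_below d)"
      using pr by force
  qed (auto simp: polys_below_def split: if_splits)
  moreover have "inj_on (\<lambda>(c, p). pCons c p) (UNIV \<times> polys_below d :: ('a \<times> 'a poly) set)"
    by (auto intro!: inj_onI)
  ultimately show ?case
    using Suc by (simp add: card_image card_cartesian_product)
qed

lemma monics_card:
  "finite (monics d :: 'a::finite_field poly set) \<and> card (monics d :: 'a poly set) = CARD('a) ^ d"
proof -
  have "bij_betw (\<lambda>p. p - monom 1 d) (monics d) (polys_below d :: 'a poly set)"
  proof (rule bij_betwI[where g = "\<lambda>p. p + monom 1 d"])
    show "(\<lambda>p. p - monom 1 d) \<in> monics d \<rightarrow> (polys_below d :: 'a poly set)"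
    proof
      fix p :: "'a poly" assume p: "p \<in> monics d"
      have "coeff (p - monom 1 d) n = 0" if "d \<le> n" for n
        using p that coeff_eq_0[of p n] by (cases "n = d") (auto simp: monics_def)
      then have "p - monom 1 d = 0 \<or> degree (p - monom 1 d) < d"
        by (metis leading_coeff_0_iff not_le)
      then show "p - monom 1 d \<in> polys_below d" by (simp add: polys_below_def)
    qed
    show "(\<lambda>p. p + monom 1 d) \<in> polys_below d \<rightarrow> (monics d :: 'a poly set)"
    proof
      fix p :: "'a poly" assume "p \<in> polys_below d"
      then have "coeff p d = 0" "p = 0 \<or> degree p < degree (monom (1 :: 'a) d)"
        by (auto simp: polys_below_def degree_monom_eq coeff_eq_0)
      then have "degree (p + monom 1 d) = d \<and> lead_coeff (p + monom 1 d) = 1"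
        by (auto simp: degree_add_eq_right degree_monom_eq)
      then show "p + monom 1 d \<in> monics d" unfolding monics_def by blast
    qed
  qed auto
  then show ?thesis
    using polys_below_card[of d] bij_betw_finite bij_betw_same_card by metis
qed

lemma finite_monics_below: "finite (monics_below d :: 'a::finite_field poly set)"
proof (rule finite_subset)
  show "monics_below d \<subseteq> (polys_below d :: 'a poly set)"
    by (auto simp: monics_below_def polys_below_def)
qed (use polys_below_card in auto)

text \<open>Every nonzero polynomial is \<open>c p\<close> with \<open>p\<close> monic, and \<open>c ^ n = 1\<close> for \<open>(q - 1) dvd n\<close>.\<close>

lemma power_sum_polys_below:
  assumes "(CARD('a) - 1) dvd n" "n > 0"
  shows "(\<Sum>p\<in>polys_below d - {0}. (1 / to_K_inf p) ^ n) =
    - (S_power_sum_below d n :: 'a::finite_field fls)"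
proof -
  have card_gt_1: "CARD('a) > 1"
    using finite_field_power_card_eq_same[of "0 :: 'a"]
      card_mono[of UNIV "{0, 1 :: 'a}"] by simp
  have c_power: "c ^ n = 1" if "c \<noteq> 0" for c :: 'a
  proof -
    have "c * c ^ (CARD('a) - 1) = c * 1"
      using finite_field_power_card_eq_same[of c] card_gt_1 by (simp flip: power_Suc)
    then have "c ^ (CARD('a) - 1) = 1" using that by simp
    then show ?thesis using assms(1) by (auto simp: power_mult elim!: dvdE)
  qed
  have "bij_betw (\<lambda>(c, p). smult c p) ((UNIV - {0}) \<times> monics_below d)
      (polys_below d - {0 :: 'a poly})"
    by (rule bij_betwI[where g = "\<lambda>p. (lead_coeff p, smult (1 / lead_coeff p) p)"])
       (auto simp: monics_below_def polys_below_def)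
  then have "(\<Sum>p\<in>polys_below d - {0 :: 'a poly}. (1 / to_K_inf p) ^ n) =
      (\<Sum>x\<in>(UNIV - {0}) \<times> monics_below d. (1 / to_K_inf (case x of (c, p) \<Rightarrow> smult c p)) ^ n)"
    by (rule sum.reindex_bij_betw[symmetric])
  also have "\<dots> = (\<Sum>(c, p)\<in>(UNIV - {0 :: 'a}) \<times> monics_below d. (1 / to_K_inf p) ^ n)"
  proof (rule sum.cong[OF refl])
    fix x :: "'a \<times> 'a poly" assume x: "x \<in> (UNIV - {0}) \<times> monics_below d"
    obtain c p where cp: "x = (c, p)" by (cases x)
    have "(fls_const c) ^ n = (1 :: 'a fls)"
      using c_power[of c] x cp by (simp flip: fls_const_power)
    then show "(1 / to_K_inf (case x of (c, p) \<Rightarrow> smult c p)) ^ n =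
        (case x of (c, p) \<Rightarrow> (1 / to_K_inf p) ^ n)"
      by (simp add: cp to_K_inf_smult power_divide power_mult_distrib)
  qed
  also have "\<dots> = (\<Sum>c\<in>UNIV - {0 :: 'a}. S_power_sum_below d n)"
    by (simp add: S_power_sum_below_def flip: sum.cartesian_product)
  also have "\<dots> = - S_power_sum_below d n"
  proof -
    \<comment> \<open>The sum has \<open>q - 1\<close> equal terms, and \<open>q\<close> is zero in
      the field.\<close>
    have "of_nat (CARD('a) - 1) = (- 1 :: 'a fls)"
      using card_gt_1 of_nat_card_eq_0[where ?'a = 'a] by (simp add: of_nat_diff fls_of_nat)
    then show ?thesis by (simp add: card_Diff_singleton)
  qed
  finally show ?thesis .
qed

section \<open>Carlitz polynomials on \<open>A\<close> inside \<open>K_\<infinity>\<close>\<close>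

locale K_inf_char_2 =
  fixes dummy :: "'a::finite_field itself" and e :: nat
  assumes card_eq: "CARD('a) = 2 ^ e"
begin

lemma e_pos: "e > 0"
  using card_eq card_mono[of UNIV "{0, 1 :: 'a}"] by (cases e) auto

lemma char_2: "CHAR('a) = 2"
proof -
  have "CHAR('a) dvd 2 ^ e"
    using of_nat_card_eq_0[where ?'a = 'a] by (simp only: of_nat_eq_0_iff_char_dvd card_eq)
  then show ?thesis
    using CHAR_prime[where ?'a = 'a] prime_dvd_power primes_dvd_imp_eq two_is_prime_nat by blast
qed

text \<open>\<open>fls_X_inv\<close> is \<open>t\<close>; its valuation \<open>-1\<close> differs
  from the valuation \<open>- q^n\<close> of \<open>t^(q^n)\<close>.\<close>

sublocale carlitz "fls_X_inv :: 'a fls" "CARD('a)" e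
proof
  show "CHAR('a fls) = 2" using char_2 by simp
  show "fls_X_inv ^ (CARD('a) ^ n) \<noteq> (fls_X_inv :: 'a fls)" if "n > 0" for n
  proof -
    have "CARD('a) ^ n > 1"
      unfolding card_eq using that e_pos by (intro one_less_power) simp_all
    moreover have "fls_subdegree (fls_X_inv ^ (CARD('a) ^ n) :: 'a fls) = - int (CARD('a) ^ n)"
      by (rule fls_subdegree_fls_X_inv_pow)
    ultimately show ?thesis by (metis fls_X_inv_subdegree neg_equal_iff_equal of_nat_1 of_nat_eq_iff less_irrefl)
  qed
qed (use card_eq e_pos in auto)

lemma to_K_inf_bracket_eq_br: "to_K_inf (bracket n :: 'a poly) = br n"
  by (simp add: to_K_inf_bracket br_def diff_eq_add)

text \<open>Induction along \<open>c + t p\<close>: for \<open>d > 0\<close> the constant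
  contributes nothing, \<open>eps d\<close> vanishes at \<open>p\<close>, and what remains is the
  \<open>q\<close>-th power of a coefficient of \<open>p\<close>, which Frobenius fixes. Thus monic
  polynomials of degree \<open>d\<close> go to 1 and polynomials of lower degree to 0.\<close>

lemma eps_to_K_inf:
  "degree p \<le> d \<Longrightarrow> eps d (to_K_inf p) = fls_const (coeff p d :: 'a)"
proof (induction p arbitrary: d)
  case 0
  then show ?case by simp
next
  case (pCons c p)
  have c: "fls_const c ^ CARD('a) = fls_const c"
    by (simp add: finite_field_power_card_eq_same flip: fls_const_power)
  show ?case
  proof (cases d)
    case 0
    then show ?thesis using pCons.prems by (auto simp: to_K_inf_pCons split: if_splits)
  next
    case (Suc d')
    have deg: "degree p \<le> d'" using pCons.prems Suc by (auto split: if_splits)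
    then have "eps d (to_K_inf (pCons c p)) = fls_X_inv * eps d (to_K_inf p) + eps d' (to_K_inf p) ^ CARD('a)"
      unfolding Suc to_K_inf_pCons eps_add eps_const[OF c] eps_t_mult by simp
    also have "eps d (to_K_inf p) = 0"
      using pCons.IH[of d] deg Suc by (simp add: coeff_eq_0)
    also have "eps d' (to_K_inf p) = fls_const (coeff p d')"
      using pCons.IH[of d'] deg by simp
    finally show ?thesis
      by (simp add: Suc finite_field_power_card_eq_same flip: fls_const_power)
  qed
qed

lemma S_power_sum_recurrence:
  "power_sum_recurrence CARD('a) (S_power_sum d :: nat \<Rightarrow> 'a fls) (coef d 0) (coef d 1)"
proof -
  have inj: "inj_on to_K_inf (monics d :: 'a poly set)"
    using inj_to_K_inf by (rule inj_on_subset) simp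
  have "power_sum_recurrence CARD('a) (\<lambda>n. \<Sum>a\<in>to_K_inf ` (monics d :: 'a poly set). (1 / a) ^ n)
      (coef d 0) (coef d 1)"
  proof (rule power_sum_recurrence_level_set)
    show "eps d a = 1" if "a \<in> to_K_inf ` (monics d :: 'a poly set)" for a
      using that eps_to_K_inf by (auto simp: monics_def)
  qed (use monics_card[where ?'a = 'a, of d] inj in \<open>auto simp: card_image\<close>)
  also have "(\<lambda>n. \<Sum>a\<in>to_K_inf ` (monics d :: 'a poly set). (1 / a) ^ n) = S_power_sum d"
    by (simp add: fun_eq_iff S_power_sum_def sum.reindex[OF inj])
  finally show ?thesis .
qed

definition C_sum :: "nat \<Rightarrow> nat \<Rightarrow> 'a fls" where
  "C_sum d n = (if n = 0 then 1 else \<Sum>p\<in>polys_below d - {0}. (1 / to_K_inf p) ^ n)"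

lemma C_sum_recurrence:
  "zeta_recurrence CARD('a) (C_sum d) (coef d 1 / coef d 0) (coef d 2 / coef d 0)"
proof -
  let ?S = "to_K_inf ` (polys_below d :: 'a poly set)"
  have inj: "inj_on to_K_inf (A :: 'a poly set)" for A
    using inj_to_K_inf by (rule inj_on_subset) simp
  have "zeta_recurrence CARD('a) (\<lambda>n. if n = 0 then 1 else \<Sum>a\<in>?S - {0}. (1 / a) ^ n)
      (coef d 1 / coef d 0) (coef d 2 / coef d 0)"
  proof (rule zeta_recurrence_kernel)
    show "eps d a = 0" if "a \<in> ?S" for a
      using that eps_to_K_inf by (auto simp: polys_below_def coeff_eq_0)
    have "0 \<in> (polys_below d :: 'a poly set)" by (simp add: polys_below_def)
    then show "0 \<in> ?S" by force
  qed (use polys_below_card[where ?'a = 'a, of d] inj in \<open>auto simp: card_image\<close>)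
  also have "?S - {0} = to_K_inf ` (polys_below d - {0})"
    by auto
  also have "(\<lambda>n. if n = 0 then 1 else \<Sum>a\<in>to_K_inf ` (polys_below d - {0}). (1 / a) ^ n) = C_sum d"
    by (simp add: fun_eq_iff C_sum_def sum.reindex[OF inj])
  finally show ?thesis .
qed

lemma S_power_sum_below_eq_C_sum:
  assumes "(CARD('a) - 1) dvd n" "n > 0"
  shows "S_power_sum_below d n = C_sum d n"
  using power_sum_polys_below[OF assms] assms(2) by (simp add: C_sum_def minus_eq_self)

end

section \<open>Double zeta values\<close>

lemma dist_fls_eq_power_int:
  fixes x y :: "'a::group_add fls"
  assumes "x \<noteq> y"
  shows "dist x y = 2 powi (- fls_subdegree (x - y))"
  using assms by (simp add: dist_fls_def power_int_def power_one_over inverse_eq_divide)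

text \<open>Valuations of products add up, so multiplication by a nonzero \<open>c\<close> scales
  all distances by one factor.\<close>

lemma tendsto_mult_left_fls:
  fixes c :: "'a::field fls"
  assumes "(f \<longlongrightarrow> l) F"
  shows "((\<lambda>x. c * f x) \<longlongrightarrow> c * l) F"
proof (cases "c = 0")
  case False
  define K :: real where "K = 2 powi (- fls_subdegree c)"
  have dist_eq: "dist (c * x) (c * y) = K * dist x y" for x y
  proof (cases "x = y")
    case neq: False
    then have "fls_subdegree (c * x - c * y) = fls_subdegree c + fls_subdegree (x - y)"
      using False by (simp flip: right_diff_distrib)
    then show ?thesis
      using neq False power_int_add[of "2 :: real" "- fls_subdegree c" "- fls_subdegree (x - y)"]
      by (simp add: dist_fls_eq_power_int K_def)
  qed simp
  have "((\<lambda>x. K * dist (f x) l) \<longlongrightarrow> K * 0) F"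
    using assms by (intro tendsto_mult_left) (simp flip: tendsto_dist_iff)
  then show ?thesis
    by (subst tendsto_dist_iff) (simp add: dist_eq)
qed simp

text \<open>The pairs are grouped by \<open>d\<close>, the degree of \<open>a1\<close>. The sum
  starts at \<open>d = 1\<close> because \<open>a2\<close> has smaller degree than
  \<open>a1\<close>.\<close>

lemma zeta2_tendsto:
  assumes "n1 > 0" "n2 > 0"
  shows "(\<lambda>D. \<Sum>d = 1..D. S_power_sum d n1 * S_power_sum_below d n2)
    \<longlonglongrightarrow> (zeta2 (int n1) (int n2) :: 'a::finite_field fls)"
proof -
  define f :: "'a poly \<times> 'a poly \<Rightarrow> 'a fls" where
    "f = (\<lambda>(a1, a2). 1 / (to_K_inf a1 powi int n1 * to_K_inf a2 powi int n2))"
  define P :: "nat \<Rightarrow> ('a poly \<times> 'a poly) set" where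
    "P D = (\<Union>d\<in>{1..D}. monics d \<times> monics_below d)" for D
  have fin: "finite (P D)" for D
    using monics_card finite_monics_below by (auto simp: P_def)
  have P_eq: "P D = {x \<in> monic_pairs. degree (fst x) \<le> D}" for D
    by (auto simp: P_def monics_def monics_below_def monic_pairs_def)
  have "(f has_sum zeta2 (int n1) (int n2)) monic_pairs"
    unfolding zeta2_def f_def using zeta2_summable[of "int n1" "int n2"] assms
    by (intro has_sum_infsum) simp
  \<comment> \<open>The finite sets \<open>P D\<close> eventually contain any given finite set of
    pairs, so the limit over all finite subsets may be taken along them.\<close>
  moreover have "filterlim P (finite_subsets_at_top monic_pairs) sequentially"
    unfolding filterlim_finite_subsets_at_top
  proof (intro allI impI)
    fix X :: "('a poly \<times> 'a poly) set" assume X: "finite X \<and> X \<subseteq> monic_pairs"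
    obtain N where N: "\<And>x. x \<in> X \<Longrightarrow> degree (fst x) \<le> N"
      using X finite_nat_set_iff_bounded_le[of "(degree \<circ> fst) ` X"] by auto
    show "\<forall>\<^sub>F D in sequentially. finite (P D) \<and> X \<subseteq> P D \<and> P D \<subseteq> monic_pairs"
      using eventually_ge_at_top[of N]
      by eventually_elim (use fin X N in \<open>auto simp: P_eq intro: order_trans\<close>)
  qed
  ultimately have "(\<lambda>D. sum f (P D)) \<longlonglongrightarrow> zeta2 (int n1) (int n2)"
    unfolding has_sum_def by (rule filterlim_compose)
  also have "(\<lambda>D. sum f (P D)) = (\<lambda>D. \<Sum>d = 1..D. S_power_sum d n1 * S_power_sum_below d n2)"
  proof
    fix D
    have "sum f (P D) = (\<Sum>d\<in>{1..D}. sum f (monics d \<times> monics_below d))"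
      unfolding P_def
      by (rule sum.UNION_disjoint) (use monics_card finite_monics_below in \<open>auto simp: monics_def\<close>)
    also have "\<dots> = (\<Sum>d = 1..D. S_power_sum d n1 * S_power_sum_below d n2)"
      by (simp add: S_power_sum_def S_power_sum_below_def sum_product sum.cartesian_product f_def
          power_divide)
    finally show "sum f (P D) = \<dots>" .
  qed
  finally show ?thesis .
qed

lemma zeta2_eq_mult:
  fixes c :: "'a::finite_field fls"
  assumes "0 < m" "0 < n" "0 < m'" "0 < n'"
    and "\<And>d. d > 0 \<Longrightarrow> S_power_sum d m * S_power_sum_below d n =
      c * (S_power_sum d m' * S_power_sum_below d n')"
  shows "zeta2 (int m) (int n) = c * zeta2 (int m') (int n')"
proof (rule LIMSEQ_unique)
  show "(\<lambda>D. \<Sum>d = 1..D. S_power_sum d m * S_power_sum_below d n)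
      \<longlonglongrightarrow> (zeta2 (int m) (int n) :: 'a fls)"
    by (rule zeta2_tendsto) fact+
  have "(\<lambda>D. c * (\<Sum>d = 1..D. S_power_sum d m' * S_power_sum_below d n'))
      \<longlonglongrightarrow> c * zeta2 (int m') (int n')"
    by (intro tendsto_mult_left_fls zeta2_tendsto) fact+
  then show "(\<lambda>D. \<Sum>d = 1..D. S_power_sum d m * S_power_sum_below d n)
      \<longlonglongrightarrow> c * zeta2 (int m') (int n')"
    by (simp add: assms(5) sum_distrib_left)
qed

section \<open>Termwise comparison of the double sums\<close>

context K_inf_char_2
begin

abbreviation "\<beta> d \<equiv> coef d 1 / coef d 0"
abbreviation "\<alpha> d \<equiv> \<beta> d ^ (CARD('a) + 1) + coef d 2 / coef d 0"
abbreviation "\<nu> d \<equiv> coef d 0 ^ CARD('a) + coef d 1"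

text \<open>The \<open>r\<close>-th power of \<open>coef_ratio\<close> balances the change in
  \<open>S\<close> against the change in \<open>S_below\<close>. The latter is stated with a common
  factor \<open>y\<close> and not as a quotient, as \<open>\<alpha> d\<close> and
  \<open>\<beta> d\<close> vanish at \<open>d = 0\<close>.\<close>

lemma zeta2_ratio:
  assumes "0 < m" "0 < n" "0 < m'" "0 < n'"
    and S: "\<And>d. S_power_sum d m' * coef d 0 ^ r = S_power_sum d m * \<nu> d ^ r"
    and S_below: "\<And>d. \<exists>y. S_power_sum_below d n = \<alpha> d ^ r * y \<and>
      S_power_sum_below d n' = (\<beta> d ^ CARD('a)) ^ r * y"
  shows "zeta2 (int m) (int n) = (br 1 ^ CARD('a) / br 2) ^ r * zeta2 (int m') (int n')"
proof (rule zeta2_eq_mult)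
  fix d
  let ?c = "br 1 ^ CARD('a) / br 2"
  obtain y where y: "S_power_sum_below d n = \<alpha> d ^ r * y"
      "S_power_sum_below d n' = (\<beta> d ^ CARD('a)) ^ r * y"
    using S_below by blast
  have ratio: "?c ^ r * \<nu> d ^ r * (\<beta> d ^ CARD('a)) ^ r = coef d 0 ^ r * \<alpha> d ^ r"
    unfolding power_mult_distrib[symmetric] by (simp only: coef_ratio)
  have "coef d 0 ^ r * (S_power_sum d m * S_power_sum_below d n) =
      S_power_sum d m * (coef d 0 ^ r * \<alpha> d ^ r) * y"
    unfolding y by (simp only: mult_ac)
  also have "\<dots> = (S_power_sum d m * \<nu> d ^ r) * ?c ^ r * (\<beta> d ^ CARD('a)) ^ r * y"
    unfolding ratio[symmetric] by (simp only: mult_ac)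
  also have "\<dots> = coef d 0 ^ r * (?c ^ r * (S_power_sum d m' * S_power_sum_below d n'))"
    unfolding y S[symmetric] by (simp only: mult_ac)
  finally show "S_power_sum d m * S_power_sum_below d n =
      ?c ^ r * (S_power_sum d m' * S_power_sum_below d n')"
    by (rule mult_left_cancel[THEN iffD1, rotated]) (intro power_not_zero coef_0_nonzero)
qed fact+

lemma exponent_eq_sum:
  assumes "0 < u + v"
  obtains n where "0 < n" "n + u + v * CARD('a) = (u + v) * CARD('a)\<^sup>2"
proof -
  have "u * 1 + v * CARD('a) \<le> u * CARD('a) + v * CARD('a)"
    using q_ge_2 by (intro add_mono mult_left_mono) auto
  also have "\<dots> < (u + v) * CARD('a)\<^sup>2"
    using assms q_ge_2 by (simp add: power2_eq_square flip: add_mult_distrib)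
  finally have "u + v * CARD('a) < (u + v) * CARD('a)\<^sup>2" by simp
  then show ?thesis
    using that[of "(u + v) * CARD('a)\<^sup>2 - (u + v * CARD('a))"] by simp
qed

text \<open>Both \<open>q^2 - 1\<close> and \<open>q^2 - q\<close> are multiples of
  \<open>q - 1\<close>, so the sum over monic polynomials agrees with the sum over all nonzero ones,
  to which \<open>C_product\<close> applies.\<close>

lemma S_power_sum_below_product:
  assumes "u + v \<le> CARD('a)" "0 < n" "n + u + v * CARD('a) = (u + v) * CARD('a)\<^sup>2"
  shows "S_power_sum_below d n = \<alpha> d ^ u * \<beta> d ^ (CARD('a) * v)"
proof -
  interpret zeta_recurrence "CARD('a)" "C_sum d" "\<beta> d" "coef d 2 / coef d 0"
    by (rule C_sum_recurrence)
  obtain p where p: "CARD('a) = Suc p" using q_ge_2 by (cases "CARD('a)") auto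
  have "n + v * p = (u + v) * (CARD('a) + 1) * p"
    using assms(3) unfolding p by (simp add: power2_eq_square algebra_simps)
  then have "p dvd n"
    by (metis dvd_add_left_iff dvd_triv_right)
  then show ?thesis
    using S_power_sum_below_eq_C_sum[of n d] C_product[OF assms(1,3)] assms(2) p by simp
qed

text \<open>From \<open>n\<close> to \<open>n'\<close>, \<open>r\<close> of the summands
  \<open>q^2 - 1\<close> become \<open>q^2 - q\<close>, which replaces \<open>\<alpha>^r\<close> by
  \<open>\<beta>^(q r)\<close>.\<close>

lemma zeta2_ratio_product:
  assumes "0 < m" "0 < m'" "0 < n" "0 < n'" "u + v + r \<le> CARD('a)"
    and n: "n + (u + r) + v * CARD('a) = (u + v + r) * CARD('a)\<^sup>2"
    and n': "n' + u + (v + r) * CARD('a) = (u + v + r) * CARD('a)\<^sup>2"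
    and S: "\<And>d. S_power_sum d m' * coef d 0 ^ r = S_power_sum d m * \<nu> d ^ r"
  shows "zeta2 (int m) (int n) = (br 1 ^ CARD('a) / br 2) ^ r * zeta2 (int m') (int n')"
proof (rule zeta2_ratio)
  have split_powers: "a ^ (u + r) * b ^ (k * v) = a ^ r * (a ^ u * b ^ (k * v))"
    "a ^ u * b ^ (k * (v + r)) = (b ^ k) ^ r * (a ^ u * b ^ (k * v))" for a b :: "'a fls" and k
    by (simp_all add: power_add add_mult_distrib2 power_mult)
  fix d
  have "S_power_sum_below d n = \<alpha> d ^ (u + r) * \<beta> d ^ (CARD('a) * v)"
    by (rule S_power_sum_below_product) (use assms in \<open>simp_all add: ac_simps\<close>)
  moreover have "S_power_sum_below d n' = \<alpha> d ^ u * \<beta> d ^ (CARD('a) * (v + r))"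
    by (rule S_power_sum_below_product) (use assms in \<open>simp_all add: ac_simps\<close>)
  ultimately show "\<exists>y. S_power_sum_below d n = \<alpha> d ^ r * y \<and>
      S_power_sum_below d n' = (\<beta> d ^ CARD('a)) ^ r * y"
    by (intro exI[of _ "\<alpha> d ^ u * \<beta> d ^ (CARD('a) * v)"])
       (simp only: split_powers simp_thms)
qed fact+

text \<open>These are the first arguments in the theorem. Those that may exceed \<open>q^2\<close>,
  the end of the range of the recurrence, are reached from \<open>q + 1\<close> by Frobenius and
  from \<open>2 q - 1\<close> by doubling.\<close>

lemma S_power_sum_2: "S_power_sum d 2 = coef d 0 ^ 2"
  and S_power_sum_q_plus_1: "S_power_sum d (CARD('a) + 1) = coef d 0 * \<nu> d"
  and S_power_sum_q_square_plus_q: "S_power_sum d (CARD('a) * (CARD('a) + 1)) = (coef d 0 * \<nu> d) ^ CARD('a)"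
  and S_power_sum_4q_minus_2:
    "S_power_sum d (2 * (2 * CARD('a) - 1)) = (coef d 0 ^ (CARD('a) - 1) * \<nu> d) ^ 2"
  and S_power_sum_3q_minus_1:
    "2 < CARD('a) \<Longrightarrow> S_power_sum d (3 * CARD('a) - 1) = coef d 0 ^ (2 * CARD('a) - 1) * \<nu> d"
  and S_power_sum_product_ratio:
    "u + v + 1 < CARD('a) \<Longrightarrow> n + Suc u + v * CARD('a) = CARD('a)\<^sup>2 \<Longrightarrow>
      n' + u + Suc v * CARD('a) = CARD('a)\<^sup>2 \<Longrightarrow>
      coef d 0 * S_power_sum d n = \<nu> d * S_power_sum d n'"
proof -
  interpret power_sum_recurrence "CARD('a)" "S_power_sum d" "coef d 0" "coef d 1"
    by (rule S_power_sum_recurrence)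
  show "S_power_sum d 2 = coef d 0 ^ 2"
    using q_ge_2 by (intro R_small) auto
  show q1: "S_power_sum d (CARD('a) + 1) = coef d 0 * \<nu> d"
    by (rule R_q_plus_1)
  show "S_power_sum d (CARD('a) * (CARD('a) + 1)) = (coef d 0 * \<nu> d) ^ CARD('a)"
    unfolding q1[symmetric] by (rule R_frob) simp
  show "S_power_sum d (2 * (2 * CARD('a) - 1)) = (coef d 0 ^ (CARD('a) - 1) * \<nu> d) ^ 2"
    using R_double[of "2 * CARD('a) - 1"] R_mult_q_minus_1[of 2] q_ge_2 by simp
  show "S_power_sum d (3 * CARD('a) - 1) = coef d 0 ^ (2 * CARD('a) - 1) * \<nu> d"
    if "2 < CARD('a)"
    using R_mult_q_minus_1[of 3] that by simp
  show "coef d 0 * S_power_sum d n = \<nu> d * S_power_sum d n'"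
    if "u + v + 1 < CARD('a)" "n + Suc u + v * CARD('a) = CARD('a)\<^sup>2"
      "n' + u + Suc v * CARD('a) = CARD('a)\<^sup>2"
    using that by (rule R_product_ratio)
qed

text \<open>The second arguments are \<open>2 q^2 - 3 q + 1\<close> and
  \<open>2 q^2 - 4 q + 2\<close>, as in parts (2) and (3) of the theorem. The two lower sums share
  the factor \<open>\<beta>^(q - 2)\<close>.\<close>

lemma zeta2_ratio_square:
  assumes "0 < m" "0 < m'"
    and S: "\<And>d. S_power_sum d m' * coef d 0 = S_power_sum d m * \<nu> d"
  shows "zeta2 (int m) (int ((CARD('a) - 1) * (2 * CARD('a) - 1))) =
    br 1 ^ CARD('a) / br 2 * zeta2 (int m') (int (2 * (CARD('a) - 1)\<^sup>2))"
proof -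
  let ?n = "(CARD('a) - 1) * (2 * CARD('a) - 1)" and ?n' = "2 * (CARD('a) - 1)\<^sup>2"
  have pos: "0 < ?n" "0 < ?n'" using q_ge_2 by auto
  have "zeta2 (int m) (int ?n) = (br 1 ^ CARD('a) / br 2) ^ 1 * zeta2 (int m') (int ?n')"
  proof (rule zeta2_ratio)
    fix d
    interpret zeta_recurrence "CARD('a)" "C_sum d" "\<beta> d" "coef d 2 / coef d 0"
      by (rule C_sum_recurrence)
    have "S_power_sum_below d ?n = \<alpha> d * \<beta> d ^ (CARD('a) - 2)"
      using S_power_sum_below_eq_C_sum[of ?n d] C_q_minus_1_two_q_minus_1 pos by simp
    moreover have "S_power_sum_below d ?n' = \<beta> d ^ (2 * (CARD('a) - 1))"
      using S_power_sum_below_eq_C_sum[of ?n' d] C_two_q_minus_1_square pos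
      by (simp add: power2_eq_square)
    moreover have "2 * (CARD('a) - 1) = CARD('a) + (CARD('a) - 2)"
      using q_ge_2 by simp
    ultimately show "\<exists>y. S_power_sum_below d ?n = \<alpha> d ^ 1 * y \<and>
        S_power_sum_below d ?n' = (\<beta> d ^ CARD('a)) ^ 1 * y"
      by (intro exI[of _ "\<beta> d ^ (CARD('a) - 2)"]) (simp only: power_one_right power_add simp_thms)
  qed (use assms pos in simp_all)
  then show ?thesis by simp
qed

end

text \<open>\<open>u\<close> and \<open>v\<close> count the indices with \<open>k i = 0\<close> and
  with \<open>k i = 1\<close>.\<close>

lemma sum_power_binary:
  fixes x :: "'b::comm_semiring_1"
  assumes "finite I" "\<forall>i\<in>I. k i \<in> {0, 1::nat}"
  obtains u v where "u + v = card I" "(\<Sum>i\<in>I. x ^ k i) = of_nat u + of_nat v * x"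
  using assms
proof (induction I arbitrary: thesis rule: finite_induct)
  case empty
  then show ?case by simp
next
  case (insert i I)
  then obtain u v where uv: "u + v = card I" "(\<Sum>i\<in>I. x ^ k i) = of_nat u + of_nat v * x"
    by (metis insertI2)
  consider "k i = 0" | "k i = 1" using insert.prems(2) by auto
  then show ?case
  proof cases
    case 1
    then show ?thesis
      using insert.prems(1)[of "Suc u" v] uv insert.hyps by (simp add: algebra_simps)
  next
    case 2
    then show ?thesis
      using insert.prems(1)[of u "Suc v"] uv insert.hyps by (simp add: algebra_simps)
  qed
qed

theorem theorem3:
  fixes q :: int
  assumes "q = int CARD('a::finite_field)"
    and "\<exists>m::nat. q = 2 ^ m"
  shows
    "(\<forall>(s::nat) (k::nat \<Rightarrow> nat) (b::int) (b'::int).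
        1 \<le> s \<and> int s \<le> q \<and> (\<forall>i\<in>{1..s-1}. k i \<in> {0, 1}) \<and> mono_on {1..s-1} k \<and>
        b = int s * q\<^sup>2 - (\<Sum>i=1..s-1. q ^ k i) - 1 \<and>
        b' = int s * q\<^sup>2 - (\<Sum>i=1..s-1. q ^ k i) - q \<longrightarrow>
        (zeta2 2 b :: 'a fls) =
          to_K_inf (bracket 1) powi q / to_K_inf (bracket 2) * zeta2 (q + 1) b')
     \<and>
     (zeta2 2 (2 * q\<^sup>2 - 3 * q + 1) :: 'a fls) =
       to_K_inf (bracket 1) powi q / to_K_inf (bracket 2)
         * zeta2 (q + 1) (2 * q\<^sup>2 - 4 * q + 2)
     \<and>
     (\<forall>(s::nat) (k::nat \<Rightarrow> nat) (l::nat \<Rightarrow> nat).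
        1 \<le> s \<and> int s < q \<and>
        (\<forall>i\<in>{1..s}. k i \<in> {0, 1}) \<and> (\<forall>i\<in>{1..s}. l i \<in> {0, 1}) \<and>
        mono_on {1..s} l \<and> mono_on {1..s} k \<and>
        (\<forall>i\<in>{1..s}. l i \<le> k i) \<and> (\<exists>!i. i \<in> {1..s} \<and> l i < k i) \<longrightarrow>
        (zeta2 (q\<^sup>2 - (\<Sum>i=1..s. q ^ k i)) (2 * q\<^sup>2 - 3 * q + 1) :: 'a fls) =
          to_K_inf (bracket 1) powi q / to_K_inf (bracket 2)
            * zeta2 (q\<^sup>2 - (\<Sum>i=1..s. q ^ l i)) (2 * q\<^sup>2 - 4 * q + 2))
     \<and>
     (\<forall>(i::int) (j::int) (b::int) (b'::int).
        0 \<le> i \<and> i \<le> 2 \<and> 0 \<le> j \<and> j \<le> 2 - i \<and>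
        b = q ^ 3 - i * q\<^sup>2 - j * q - (q - i - j) \<and>
        b' = q ^ 3 - i * q\<^sup>2 - (q - (2 - j)) * q - (2 - i - j) \<longrightarrow>
        (zeta2 (4 * q - 2) b :: 'a fls) =
          to_K_inf (bracket 1) powi ((q - 2) * q) / to_K_inf (bracket 2) powi (q - 2)
            * zeta2 (q\<^sup>2 + q) b')
     \<and>
     (q > 2 \<longrightarrow>
       (\<forall>i::nat. i \<le> 2 \<longrightarrow>
         (zeta2 (3 * q - 1) (q ^ 3 - (q - 1) - q ^ i) :: 'a fls) =
           to_K_inf (bracket 1) powi ((q - 1) * q) / to_K_inf (bracket 2) powi (q - 1)
             * zeta2 (q\<^sup>2 + q) (q ^ 3 - (q - 1) * q - q ^ i)))"
proof -
  obtain e where "q = 2 ^ e" using assms(2) by blast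
  then have "CARD('a) = 2 ^ e" using assms(1) by (metis of_nat_eq_iff of_nat_numeral of_nat_power)
  then interpret K_inf_char_2 "TYPE('a)" e by unfold_locales
  let ?Q = "CARD('a)"
  have q: "q = int ?Q" using assms(1) by simp
  have Q2: "2 \<le> ?Q" by (rule q_ge_2)
  define \<kappa> where "\<kappa> = br 1 ^ ?Q / br 2"
  have \<kappa>: "to_K_inf (bracket 1 :: 'a poly) powi q / to_K_inf (bracket 2 :: 'a poly) = \<kappa>"
    by (simp add: q \<kappa>_def to_K_inf_bracket_eq_br)
  have \<kappa>_power: "to_K_inf (bracket 1 :: 'a poly) powi (int r * q) / to_K_inf (bracket 2 :: 'a poly) powi int r
      = \<kappa> ^ r" for r
    by (simp add: q \<kappa>_def to_K_inf_bracket_eq_br power_divide mult.commute flip: of_nat_mult power_mult)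
  have ratio_1: "S_power_sum d (?Q + 1) * coef d 0 = S_power_sum d 2 * \<nu> d" for d
    unfolding S_power_sum_q_plus_1 S_power_sum_2 by (simp add: power2_eq_square)
  have exponent: "\<exists>n>0. n + u + v * ?Q = (u + v) * ?Q\<^sup>2 \<and>
      int n = (int u + int v) * q\<^sup>2 - int u - int v * q" if pos: "0 < u + v" for u v
  proof -
    obtain n where n: "0 < n" "n + u + v * ?Q = (u + v) * ?Q\<^sup>2"
      by (rule exponent_eq_sum[OF pos])
    have "int n + int u + int v * q = (int u + int v) * q\<^sup>2"
      using arg_cong[OF n(2), of int] by (simp add: q)
    then show ?thesis using n by (intro exI[of _ n]) auto
  qed
  \<comment> \<open>Parts (1), (4) and (5) are instances of this, with \<open>r\<close> equal to
    \<open>1\<close>, \<open>q - 2\<close> and \<open>q - 1\<close>.\<close>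
  have product: "zeta2 (int m) b = \<kappa> ^ r * (zeta2 (int m') b' :: 'a fls)"
    if "0 < m" "0 < m'" "0 < u + v + r" "u + v + r \<le> ?Q"
      and b: "b = (int u + int v + int r) * q\<^sup>2 - (int u + int r) - int v * q"
      and b': "b' = (int u + int v + int r) * q\<^sup>2 - int u - (int v + int r) * q"
      and S: "\<And>d. S_power_sum d m' * coef d 0 ^ r = S_power_sum d m * \<nu> d ^ r"
    for m m' u v r :: nat and b b' :: int
  proof -
    obtain n where n: "0 < n" "n + (u + r) + v * ?Q = (u + r + v) * ?Q\<^sup>2"
        "int n = (int (u + r) + int v) * q\<^sup>2 - int (u + r) - int v * q"
      using exponent[of "u + r" v] \<open>0 < u + v + r\<close> by auto
    obtain n' where n': "0 < n'" "n' + u + (v + r) * ?Q = (u + (v + r)) * ?Q\<^sup>2"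
        "int n' = (int u + int (v + r)) * q\<^sup>2 - int u - int (v + r) * q"
      using exponent[of u "v + r"] \<open>0 < u + v + r\<close> by auto
    have "b = int n" "b' = int n'"
      using n(3) n'(3) by (simp_all add: b b' algebra_simps)
    then show ?thesis
      using zeta2_ratio_product[of m m' n n' u v r] that n n'
      by (simp add: \<kappa>_def ac_simps)
  qed
  \<comment> \<open>Parts (2) and (3) have the same second arguments and differ only in the first
    ones.\<close>
  have square: "zeta2 (int m) (2 * q\<^sup>2 - 3 * q + 1) = \<kappa> * (zeta2 (int m') (2 * q\<^sup>2 - 4 * q + 2) :: 'a fls)"
    if "0 < m" "0 < m'" and S: "\<And>d. S_power_sum d m' * coef d 0 = S_power_sum d m * \<nu> d"
    for m m' :: nat
  proof -
    obtain p where p: "?Q = p + 2" using Q2 by (metis le_Suc_ex add.commute)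
    have "2 * q\<^sup>2 - 3 * q + 1 = int ((?Q - 1) * (2 * ?Q - 1))"
      "2 * q\<^sup>2 - 4 * q + 2 = int (2 * (?Q - 1)\<^sup>2)"
      unfolding q p by (simp_all add: power2_eq_square algebra_simps)
    then show ?thesis
      using zeta2_ratio_square[OF that] by (simp only: \<kappa>_def)
  qed
  show ?thesis
  proof (intro conjI allI impI; (elim conjE)?)
    fix s :: nat and k :: "nat \<Rightarrow> nat" and b b' :: int
    assume s: "1 \<le> s" "int s \<le> q" and k: "\<forall>i\<in>{1..s-1}. k i \<in> {0, 1}"
      and b: "b = int s * q\<^sup>2 - (\<Sum>i=1..s-1. q ^ k i) - 1"
      and b': "b' = int s * q\<^sup>2 - (\<Sum>i=1..s-1. q ^ k i) - q"
    obtain u v where uv: "u + v = card {1..s-1}" "(\<Sum>i=1..s-1. q ^ k i) = int u + int v * q"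
      using sum_power_binary[of "{1..s-1}" k q] k by auto
    \<comment> \<open>The \<open>u + v\<close> terms of the sum use up \<open>s - 1\<close> of the
      \<open>s\<close> copies of \<open>q^2\<close>; the last copy goes with the final
      \<open>1\<close> or \<open>q\<close>, whence \<open>r = 1\<close>.\<close>
    have s_eq: "int s = int u + int v + 1" using uv(1) s(1) by simp
    have "zeta2 (int 2) b = \<kappa> ^ 1 * (zeta2 (int (?Q + 1)) b' :: 'a fls)"
    proof (rule product)
      show "b = (int u + int v + int 1) * q\<^sup>2 - (int u + int 1) - int v * q"
        unfolding b uv(2) s_eq by (simp add: algebra_simps)
      show "b' = (int u + int v + int 1) * q\<^sup>2 - int u - (int v + int 1) * q"
        unfolding b' uv(2) s_eq by (simp add: algebra_simps)
    qed (use s s_eq q ratio_1 in auto)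
    then show "(zeta2 2 b :: 'a fls) =
          to_K_inf (bracket 1) powi q / to_K_inf (bracket 2) * zeta2 (q + 1) b'"
      unfolding \<kappa> by (simp add: q add.commute)
  next
    show "(zeta2 2 (2 * q\<^sup>2 - 3 * q + 1) :: 'a fls) =
       to_K_inf (bracket 1) powi q / to_K_inf (bracket 2)
         * zeta2 (q + 1) (2 * q\<^sup>2 - 4 * q + 2)"
      unfolding \<kappa> using square[of 2 "?Q + 1"] ratio_1 by (simp add: q add.commute)
  next
    fix s :: nat and k l :: "nat \<Rightarrow> nat"
    assume s: "1 \<le> s" "int s < q"
      and k: "\<forall>i\<in>{1..s}. k i \<in> {0, 1}" and l: "\<forall>i\<in>{1..s}. l i \<in> {0, 1}"
      and le: "\<forall>i\<in>{1..s}. l i \<le> k i" and ex1: "\<exists>!i. i \<in> {1..s} \<and> l i < k i"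
    obtain j where j: "j \<in> {1..s}" "l j < k j" and j_unique: "\<And>i. i \<in> {1..s} \<Longrightarrow> l i < k i \<Longrightarrow> i = j"
      using ex1 by blast
    have "l j \<in> {0, 1}" "k j \<in> {0, 1}" using j(1) k l by blast+
    \<comment> \<open>At \<open>j\<close>, the only index where \<open>l\<close> and
      \<open>k\<close> differ, a subtracted \<open>1\<close> becomes a subtracted
      \<open>q\<close>.\<close>
    then have lk: "l j = 0" "k j = 1" using j(2) by auto
    obtain u v where uv: "u + v = card ({1..s} - {j})"
        "(\<Sum>i\<in>{1..s} - {j}. q ^ l i) = int u + int v * q"
      using sum_power_binary[of "{1..s} - {j}" l q] l by auto
    have "(\<Sum>i\<in>{1..s} - {j}. q ^ k i) = (\<Sum>i\<in>{1..s} - {j}. q ^ l i)"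
      by (intro sum.cong refl arg_cong[of _ _ "power q"])
         (metis DiffE insertI1 j_unique le le_neq_implies_less)
    then have sum_k: "(\<Sum>i=1..s. q ^ k i) = int u + (int v + 1) * q"
      and sum_l: "(\<Sum>i=1..s. q ^ l i) = int u + 1 + int v * q"
      using j(1) uv(2) lk by (simp_all add: sum.remove algebra_simps)
    have s_eq: "s = u + v + 1" using uv(1) s(1) j(1) by simp
    have lt: "u + v + 1 < ?Q" using s s_eq q by simp
    \<comment> \<open>The bound \<open>s < q\<close> makes both first arguments positive, so they
      can be taken as natural numbers.\<close>
    have "(u + v + 1) * ?Q < ?Q\<^sup>2"
      unfolding power2_eq_square by (rule mult_strict_right_mono[OF lt]) simp
    moreover have "u * 1 \<le> u * ?Q" using Q2 by (intro mult_left_mono) auto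
    ultimately have less: "u + Suc v * ?Q < ?Q\<^sup>2"
      unfolding add_mult_distrib mult_Suc by linarith
    obtain n' where n': "0 < n'" "n' + u + Suc v * ?Q = ?Q\<^sup>2"
      using less_imp_add_positive[OF less] by (auto simp: ac_simps)
    have "Suc u + v * ?Q < ?Q\<^sup>2" using less Q2 by simp
    then obtain n where n: "0 < n" "n + Suc u + v * ?Q = ?Q\<^sup>2"
      using less_imp_add_positive[of "Suc u + v * ?Q" "?Q\<^sup>2"] by (auto simp: ac_simps)
    have eq: "q\<^sup>2 - (\<Sum>i=1..s. q ^ k i) = int n'" "q\<^sup>2 - (\<Sum>i=1..s. q ^ l i) = int n"
      using arg_cong[OF n(2), of int] arg_cong[OF n'(2), of int]
      unfolding sum_k sum_l by (simp_all add: q algebra_simps)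
    have "S_power_sum d n * coef d 0 = S_power_sum d n' * \<nu> d" for d
      using S_power_sum_product_ratio[of u v n n' d] lt n n' by (simp add: mult.commute)
    then show "(zeta2 (q\<^sup>2 - (\<Sum>i=1..s. q ^ k i)) (2 * q\<^sup>2 - 3 * q + 1) :: 'a fls) =
          to_K_inf (bracket 1) powi q / to_K_inf (bracket 2)
            * zeta2 (q\<^sup>2 - (\<Sum>i=1..s. q ^ l i)) (2 * q\<^sup>2 - 4 * q + 2)"
      unfolding eq \<kappa> using n(1) n'(1) by (intro square)
  next
    fix i j b b' :: int
    assume ij: "0 \<le> i" "i \<le> 2" "0 \<le> j" "j \<le> 2 - i"
      and b: "b = q ^ 3 - i * q\<^sup>2 - j * q - (q - i - j)"
      and b': "b' = q ^ 3 - i * q\<^sup>2 - (q - (2 - j)) * q - (2 - i - j)"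
    \<comment> \<open>With \<open>x = e0\<close> and \<open>y = \<nu>\<close> this is the relation
      between the values of \<open>S_d\<close>; both sides are
      \<open>x^(2 q - 2) * y^q\<close>.\<close>
    have powers_4: "(x * y) ^ ?Q * x ^ (?Q - 2) = (x ^ (?Q - 1) * y)\<^sup>2 * y ^ (?Q - 2)" for x y :: "'a fls"
    proof -
      obtain p where p: "?Q = p + 2" using Q2 by (metis le_Suc_ex add.commute)
      show ?thesis unfolding p by (simp add: power_mult_distrib power_add power2_eq_square mult_ac)
    qed
    have r: "q - 2 = int (?Q - 2)" using Q2 by (simp add: q of_nat_diff)
    have "zeta2 (int (2 * (2 * ?Q - 1))) b = \<kappa> ^ (?Q - 2) * (zeta2 (int (?Q * (?Q + 1))) b' :: 'a fls)"
    \<comment> \<open>For \<open>q = 2\<close> both sides are the same expression. This disposes of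
      \<open>i = 2\<close>, \<open>q = 2\<close>, where \<open>b = 0\<close> and
      \<open>u + v + r = 0\<close>, so that \<open>product\<close> does not apply.\<close>
    proof (cases "?Q = 2")
      case True
      then show ?thesis by (simp add: b b' q)
    next
      case False
      show ?thesis
      \<comment> \<open>Here \<open>u = 2 - i - j\<close>, \<open>v = j\<close> and
        \<open>r = q - 2\<close>, so that \<open>u + v + r = q - i\<close>.\<close>
      proof (rule product)
        show "b = (int (nat (2 - i - j)) + int (nat j) + int (?Q - 2)) * q\<^sup>2
            - (int (nat (2 - i - j)) + int (?Q - 2)) - int (nat j) * q"
          using ij unfolding b r[symmetric] by (simp add: power3_eq_cube power2_eq_square algebra_simps)
        show "b' = (int (nat (2 - i - j)) + int (nat j) + int (?Q - 2)) * q\<^sup>2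
            - int (nat (2 - i - j)) - (int (nat j) + int (?Q - 2)) * q"
          using ij unfolding b' r[symmetric] by (simp add: power3_eq_cube power2_eq_square algebra_simps)
        show "nat (2 - i - j) + nat j + (?Q - 2) \<le> ?Q" "0 < nat (2 - i - j) + nat j + (?Q - 2)"
          using ij Q2 False by simp_all
        show "S_power_sum d (?Q * (?Q + 1)) * coef d 0 ^ (?Q - 2) =
            S_power_sum d (2 * (2 * ?Q - 1)) * \<nu> d ^ (?Q - 2)" for d
          unfolding S_power_sum_q_square_plus_q S_power_sum_4q_minus_2 by (rule powers_4)
      qed (use Q2 in auto)
    qed
    moreover have "int (2 * (2 * ?Q - 1)) = 4 * q - 2" "int (?Q * (?Q + 1)) = q\<^sup>2 + q"
      using Q2 by (simp_all add: q power2_eq_square of_nat_diff algebra_simps)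
    ultimately show "(zeta2 (4 * q - 2) b :: 'a fls) =
          to_K_inf (bracket 1) powi ((q - 2) * q) / to_K_inf (bracket 2) powi (q - 2)
            * zeta2 (q\<^sup>2 + q) b'"
      by (simp only: r \<kappa>_power)
  next
    fix i :: nat
    assume q_gt_2: "2 < q" and i: "i \<le> 2"
    have r: "q - 1 = int (?Q - 1)" using Q2 by (simp add: q of_nat_diff)
    \<comment> \<open>Besides the \<open>r = q - 1\<close> summands that change,
      \<open>i = 0\<close> leaves one summand \<open>q^2 - 1\<close>, \<open>i = 1\<close> one
      summand \<open>q^2 - q\<close>, and \<open>i = 2\<close> none.\<close>
    obtain u v :: nat where uv: "u + v \<le> 1"
        "q ^ i = q\<^sup>2 - (int u + int v) * q\<^sup>2 + int u + int v * q"
    proof -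
      consider "i = 0" | "i = 1" | "i = 2" using i by linarith
      then show ?thesis
        using that[of 1 0] that[of 0 1] that[of 0 0] by cases auto
    qed
    have powers_5: "(x * y) ^ ?Q * x ^ (?Q - 1) = x ^ (2 * ?Q - 1) * y * y ^ (?Q - 1)" for x y :: "'a fls"
    proof -
      obtain p where p: "?Q = p + 2" using Q2 by (metis le_Suc_ex add.commute)
      show ?thesis unfolding p by (simp add: power_mult_distrib power_add mult_2_right mult_ac)
    qed
    have "zeta2 (int (3 * ?Q - 1)) (q ^ 3 - (q - 1) - q ^ i) =
        \<kappa> ^ (?Q - 1) * (zeta2 (int (?Q * (?Q + 1))) (q ^ 3 - (q - 1) * q - q ^ i) :: 'a fls)"
    proof (rule product)
      show "q ^ 3 - (q - 1) - q ^ i = (int u + int v + int (?Q - 1)) * q\<^sup>2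
          - (int u + int (?Q - 1)) - int v * q"
        unfolding uv(2) r[symmetric] by (simp add: power3_eq_cube power2_eq_square algebra_simps)
      show "q ^ 3 - (q - 1) * q - q ^ i = (int u + int v + int (?Q - 1)) * q\<^sup>2
          - int u - (int v + int (?Q - 1)) * q"
        unfolding uv(2) r[symmetric] by (simp add: power3_eq_cube power2_eq_square algebra_simps)
      show "S_power_sum d (?Q * (?Q + 1)) * coef d 0 ^ (?Q - 1) =
          S_power_sum d (3 * ?Q - 1) * \<nu> d ^ (?Q - 1)" for d
        using q_gt_2 q S_power_sum_3q_minus_1[of d] powers_5
        unfolding S_power_sum_q_square_plus_q by simp
    qed (use Q2 uv(1) in auto)
    moreover have "int (3 * ?Q - 1) = 3 * q - 1" "int (?Q * (?Q + 1)) = q\<^sup>2 + q"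
      using Q2 by (simp_all add: q power2_eq_square of_nat_diff algebra_simps)
    ultimately show "(zeta2 (3 * q - 1) (q ^ 3 - (q - 1) - q ^ i) :: 'a fls) =
           to_K_inf (bracket 1) powi ((q - 1) * q) / to_K_inf (bracket 2) powi (q - 1)
             * zeta2 (q\<^sup>2 + q) (q ^ 3 - (q - 1) * q - q ^ i)"
      by (simp only: r \<kappa>_power)
  qed
qed

end
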